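(* Let $G$ be a self-small abelian group of finite torsion-free rank, and let $n$ be a positive integer. Fix a direct decomposition $G=T_n(G)\oplus G(n)$. Suppose that there exists a torsion-free abelian group $H$ such that: (I) there exists a rigid epimorphism $\alpha:H\to G(n)/nG(n)$; (II) $\mathrm{Hom}(G,H)=0$; (III) $\mathrm{Hom}(H,G)$ is a torsion group. If $G$ has the cancellation property, then every unit of the ring $\mathrm{End}_{\mathrm{W}}(G)/n\,\mathrm{End}_{\mathrm{W}}(G)$ lifts to a unit of $\mathrm{End}_{\mathrm{W}}(G)$, i.e. every unit of the quotient ring is the image of a unit of $\mathrm{End}_{\mathrm{W}}(G)$ under the canonical projection.
   Context: All groups are abelian. A group $G$ is self-small if for every index set $I$ the natural homomorphism $\mathrm{Hom}(G,G)^{(I)}\to\mathrm{Hom}(G,G^{(I)})$ is an isomorphism, where $X^{(I)}$ denotes the direct sum of $I$ copies of $X$. $T(G)$ denotes the torsion subgroup of $G$ and $T_p(G)$ its $p$-component for a prime $p$. For a positive integer $n$, $T_n(G)=\bigoplus_{p\mid n,\ p\text{ prime}}T_p(G)$. If $G$ is self-small of finite torsion-free rank, then all $T_p(G)$ are finite and $T_n(G)$ is a direct summand of $G$; $G(n)$ denotes a fixed complement, so $G=T_n(G)\oplus G(n)$. The Walk-endomorphism ring of $G$ is $\mathrm{End}_{\mathrm{W}}(G)=\mathrm{End}(G)/\mathrm{Hom}(G,T(G))$, where $\mathrm{Hom}(G,T(G))$ is viewed as the two-sided ideal of endomorphisms with image in $T(G)$. A group $G$ has the cancellation property if whenever $H,K$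 are (abelian) groups with $G\oplus H\cong G\oplus K$, then $H\cong K$. An epimorphism $\alpha:H\to L$ is rigid if whenever $\psi:H\to H$ and $\phi:L\to L$ are isomorphisms with $\alpha\psi=\phi\alpha$, one has $\phi=1_L$ or $\phi=-1_L$. *)

theory Defs
  imports "HOL-Algebra.Algebra" "HOL-Library.Infinite_Typeclass"
begin

text \<open>
  Abelian groups are written multiplicatively. One infinite type \<open>'u\<close> serves as the universe carrying \<open>G\<close>: the
  groups \<open>H\<close>, \<open>K\<close> in the cancellation property and the index sets \<open>I\<close> in the definition of
  self-smallness range over the groups, respectively sets, on \<open>'u\<close>. Any family of groups indexed by
  a set can be transported to such a type, and an infinite type is large enough to hold the direct
  sums and subgroups of finitely many groups living on it.
\<close>

section \<open>Groups of homomorphisms and the Walk-endomorphism ring\<close>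

text \<open>
  Homomorphisms are taken to be extensional, since \<^const>\<open>hom\<close> leaves the values outside
  \<^term>\<open>carrier G\<close> unspecified.
\<close>

definition hom_group :: "('a, 'm) monoid_scheme \<Rightarrow> ('b, 'k) monoid_scheme \<Rightarrow> ('a \<Rightarrow> 'b) monoid" where
  "hom_group G H =
    \<lparr>carrier = hom G H \<inter> extensional (carrier G),
     monoid.mult = (\<lambda>f g. \<lambda>x\<in>carrier G. f x \<otimes>\<^bsub>H\<^esub> g x),
     monoid.one = (\<lambda>x\<in>carrier G. \<one>\<^bsub>H\<^esub>)\<rparr>"

definition endo_ring :: "('a, 'm) monoid_scheme \<Rightarrow> ('a \<Rightarrow> 'a) ring" where
  "endo_ring G =
    \<lparr>carrier = carrier (hom_group G G),
     monoid.mult = compose (carrier G),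
     monoid.one = (\<lambda>x\<in>carrier G. x),
     ring.zero = \<one>\<^bsub>hom_group G G\<^esub>,
     ring.add = monoid.mult (hom_group G G)\<rparr>"

definition torsion_part :: "('a, 'm) monoid_scheme \<Rightarrow> 'a set" where
  "torsion_part G = {x \<in> carrier G. \<exists>m::nat. m > 0 \<and> x [^]\<^bsub>G\<^esub> m = \<one>\<^bsub>G\<^esub>}"

definition walk_ring :: "('a, 'm) monoid_scheme \<Rightarrow> ('a \<Rightarrow> 'a) set ring" where
  "walk_ring G =
    endo_ring G Quot {f \<in> carrier (endo_ring G). f ` carrier G \<subseteq> torsion_part G}"

definition multiples_ideal :: "('a, 'm) ring_scheme \<Rightarrow> nat \<Rightarrow> 'a set" where
  "multiples_ideal R n = (\<lambda>x. [n] \<cdot>\<^bsub>R\<^esub> x) ` carrier R"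

section \<open>Torsion\<close>

definition torsion_group :: "('a, 'm) monoid_scheme \<Rightarrow> bool" where
  "torsion_group G \<longleftrightarrow> torsion_part G = carrier G"

definition torsion_free_group :: "('a, 'm) monoid_scheme \<Rightarrow> bool" where
  "torsion_free_group G \<longleftrightarrow> torsion_part G = {\<one>\<^bsub>G\<^esub>}"

definition p_component :: "('a, 'm) monoid_scheme \<Rightarrow> nat \<Rightarrow> 'a set" where
  "p_component G p = {x \<in> carrier G. \<exists>k::nat. x [^]\<^bsub>G\<^esub> (p ^ k) = \<one>\<^bsub>G\<^esub>}"

text \<open>
  The sum of the \<open>p\<close>-components inside \<open>G\<close>; it is automatically direct, because elements of the
  components for different primes have coprime orders.
\<close>

definition n_torsion_part :: "('a, 'm) monoid_scheme \<Rightarrow> nat \<Rightarrow> 'a set" where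
  "n_torsion_part G n = generate G (\<Union>p\<in>{p. Factorial_Ring.prime p \<and> p dvd n}. p_component G p)"

definition independent_in :: "('a, 'm) monoid_scheme \<Rightarrow> 'a set \<Rightarrow> bool" where
  "independent_in G S \<longleftrightarrow> S \<subseteq> carrier G \<and>
    (\<forall>F (c :: 'a \<Rightarrow> int). finite F \<and> F \<subseteq> S \<and> finprod G (\<lambda>x. x [^]\<^bsub>G\<^esub> c x) F = \<one>\<^bsub>G\<^esub>
      \<longrightarrow> (\<forall>x\<in>F. c x = 0))"

text \<open>
  The torsion-free rank is the cardinality of a maximal independent set of elements of infinite
  order; \<^const>\<open>independent_in\<close> forces the elements to have infinite order.
\<close>

definition finite_torsion_free_rank :: "('a, 'm) monoid_scheme \<Rightarrow> bool" where
  "finite_torsion_free_rank G \<longleftrightarrow>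
    (\<exists>B. finite B \<and> independent_in G B \<and> (\<forall>S. independent_in G S \<and> B \<subseteq> S \<longrightarrow> S = B))"

section \<open>Self-smallness, decompositions, cancellation, rigidity\<close>

definition self_small :: "('u::infinite, 'm) monoid_scheme \<Rightarrow> bool" where
  "self_small G \<longleftrightarrow> (\<forall>I :: 'u set.
    (\<lambda>f. \<lambda>x\<in>carrier G. \<lambda>i\<in>I. f i x)
      \<in> iso (sum_group I (\<lambda>i. hom_group G G)) (hom_group G (sum_group I (\<lambda>i. G))))"

definition internal_direct_sum :: "('a, 'm) monoid_scheme \<Rightarrow> 'a set \<Rightarrow> 'a set \<Rightarrow> bool" where
  "internal_direct_sum G A B \<longleftrightarrow>
    subgroup A G \<and> subgroup B G \<and> A <#>\<^bsub>G\<^esub> B = carrier G \<and> A \<inter> B = {\<one>\<^bsub>G\<^esub>}"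

definition cancellation_property :: "('u::infinite, 'm) monoid_scheme \<Rightarrow> bool" where
  "cancellation_property G \<longleftrightarrow> (\<forall>(H :: 'u monoid) (K :: 'u monoid).
    comm_group H \<and> comm_group K \<and> G \<times>\<times> H \<cong> G \<times>\<times> K \<longrightarrow> H \<cong> K)"

definition rigid_epi :: "('a, 'm) monoid_scheme \<Rightarrow> ('b, 'k) monoid_scheme \<Rightarrow> ('a \<Rightarrow> 'b) \<Rightarrow> bool" where
  "rigid_epi H L \<alpha> \<longleftrightarrow> \<alpha> \<in> epi H L \<and>
    (\<forall>\<psi> \<in> iso H H. \<forall>\<phi> \<in> iso L L. (\<forall>x\<in>carrier H. \<alpha> (\<psi> x) = \<phi> (\<alpha> x)) \<longrightarrow>
      (\<forall>y\<in>carrier L. \<phi> y = y) \<or> (\<forall>y\<in>carrier L. \<phi> y = inv\<^bsub>L\<^esub> y))"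

definition mod_powers :: "('a, 'm) monoid_scheme \<Rightarrow> nat \<Rightarrow> 'a set monoid" where
  "mod_powers C n = C Mod ((\<lambda>x. x [^]\<^bsub>C\<^esub> n) ` carrier C)"

end

theory Submission
  imports Defs
begin

text \<open>
  An endomorphism \<open>f\<close> of \<open>C = G(n)\<close> inducing an automorphism of \<open>C/nC\<close> yields the pullback
  \<open>M\<^sub>f = {(x, h) \<in> C \<oplus> H. f x + nC = \<alpha> h}\<close>, an extension of \<open>H\<close> by \<open>nC \<cong> C\<close>. Since \<open>f\<close> and an inverse
  of it modulo \<open>n\<close> both lift to \<open>C\<close>, a Schanuel-type argument gives \<open>C \<oplus> M\<^sub>1 \<cong> C \<oplus> M\<^sub>f\<close>, so
  \<open>G \<oplus> M\<^sub>1 \<cong> G \<oplus> M\<^sub>f\<close> and, by cancellation, there is \<open>\<theta> : M\<^sub>1 \<cong> M\<^sub>f\<close>. As \<open>Hom(C, H) = 0\<close>, \<open>\<theta>\<close> respects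
  the kernels \<open>nC\<close> and induces automorphisms \<open>\<beta>\<close> of \<open>C\<close> and \<open>\<psi>\<close> of \<open>H\<close>. As \<open>Hom(H, C)\<close> is torsion and the
  torsion of \<open>C\<close> is \<open>n\<close>-divisible, \<open>\<alpha> \<psi> = \<phi> \<alpha>\<close> for the automorphism \<open>\<phi>\<close> induced by \<open>f \<beta>\<close>, whence
  \<open>f \<equiv> \<plusminus> \<beta>\<^sup>-\<^sup>1\<close> modulo \<open>n\<close> by rigidity. Extending \<open>\<plusminus> \<beta>\<^sup>-\<^sup>1\<close> by the identity on \<open>T\<^sub>n(G)\<close> lifts the unit.
\<close>

section \<open>Abelian groups without \<open>n\<close>-torsion\<close>

lemma hom_of_pow_eq:
  assumes "group A" "group B" "f \<in> hom A B" "x \<in> carrier A"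
  shows "f (x [^]\<^bsub>A\<^esub> (k::nat)) = f x [^]\<^bsub>B\<^esub> k"
  using assms by (metis group_hom.hom_nat_pow group_hom.intro group_hom_axioms.intro)

lemma group_isoI:
  assumes "group A" "group B" "f \<in> hom A B"
    and inj: "\<And>x. x \<in> carrier A \<Longrightarrow> f x = \<one>\<^bsub>B\<^esub> \<Longrightarrow> x = \<one>\<^bsub>A\<^esub>"
    and surj: "\<And>y. y \<in> carrier B \<Longrightarrow> \<exists>x\<in>carrier A. f x = y"
  shows "f \<in> iso A B"
proof -
  interpret group_hom A B f
    using assms by (simp add: group_hom_def group_hom_axioms_def)
  have "inj_on f (carrier A)"
    using inj by (simp add: inj_on_one_iff)
  moreover have "f ` carrier A = carrier B"
    using surj by force
  ultimately show ?thesis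
    using homh by (simp add: iso_def bij_betw_def)
qed

text \<open>Serves the alternative -1 in rigidity, where the lifted automorphism has to be
  negated.\<close>

lemma (in comm_group) inv_iso:
  assumes "\<beta> \<in> iso G G"
  shows "(\<lambda>x. inv (\<beta> x)) \<in> iso G G"
proof -
  have "(\<lambda>x. inv x) \<in> iso G G"
  proof (rule group_isoI[OF is_group is_group])
    show "\<exists>x\<in>carrier G. inv x = y" if "y \<in> carrier G" for y
      using that by (intro bexI[of _ "inv y"]) auto
  qed (auto simp: hom_def inv_mult)
  then show ?thesis
    using iso_set_trans[OF assms] by (simp add: comp_def)
qed

text \<open>In additive notation, multiplication by \<open>n\<close> is injective, so nG is a copy
  of \<open>G\<close>. The instance used later is the complement G(n).\<close>

locale power_injective_group = comm_group +
  fixes n :: nat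
  assumes pow_eq_one: "x \<in> carrier G \<Longrightarrow> x [^] n = \<one> \<Longrightarrow> x = \<one>"
begin

definition powers :: "'a set" where
  "powers = (\<lambda>x. x [^] n) ` carrier G"

text \<open>Division by \<open>n\<close>. The value is meaningful only on \<open>powers\<close>;
  there it is unique and hence additive.\<close>

definition root :: "'a \<Rightarrow> 'a" where
  "root = inv_into (carrier G) (\<lambda>x. x [^] n)"

definition proj :: "'a \<Rightarrow> 'a set" where
  "proj x = powers #> x"

lemma mod_powers_eq: "mod_powers G n = G Mod powers"
  by (simp add: mod_powers_def powers_def)

lemma pow_hom: "(\<lambda>x. x [^] n) \<in> hom G G"
  by (auto simp: hom_def nat_pow_distrib)

lemma subgroup_powers: "subgroup powers G"
proof -
  interpret group_hom G G "\<lambda>x. x [^] n"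
    using pow_hom by (simp add: group_hom_def group_hom_axioms_def is_group)
  show ?thesis
    unfolding powers_def by (rule img_is_subgroup)
qed

lemma normal_powers: "powers \<lhd> G"
  by (simp add: normal_iff_subgroup subgroup_powers)

lemma comm_group_mod_powers: "comm_group (mod_powers G n)"
  unfolding mod_powers_eq by (rule abelian_FactGroup[OF subgroup_powers])

lemma proj_hom: "proj \<in> hom G (mod_powers G n)"
  using normal.r_coset_hom_Mod[OF normal_powers] by (simp add: proj_def[abs_def] mod_powers_eq)

lemma carrier_mod_powers: "carrier (mod_powers G n) = proj ` carrier G"
  by (simp add: mod_powers_eq carrier_FactGroup proj_def[abs_def])

sublocale mod_powers: comm_group "mod_powers G n"
  by (rule comm_group_mod_powers)

sublocale proj: group_hom G "mod_powers G n" proj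
  by (simp add: group_hom_def group_hom_axioms_def proj_hom is_group mod_powers.is_group)

lemma powI: "x \<in> carrier G \<Longrightarrow> x [^] n \<in> powers"
  by (auto simp: powers_def)

lemma proj_eq_one_iff: "x \<in> carrier G \<Longrightarrow> proj x = \<one>\<^bsub>mod_powers G n\<^esub> \<longleftrightarrow> x \<in> powers"
  unfolding proj_def mod_powers_eq one_FactGroup
  using coset_join1[OF _ _ subgroup_powers] coset_join2[OF _ subgroup_powers] subgroup.subset[OF subgroup_powers]
  by blast

lemma proj_pow: "x \<in> carrier G \<Longrightarrow> proj (x [^] n) = \<one>\<^bsub>mod_powers G n\<^esub>"
  by (simp add: proj_eq_one_iff powI)

lemma proj_eq_iff:
  assumes "x \<in> carrier G" "y \<in> carrier G"
  shows "proj x = proj y \<longleftrightarrow> x \<otimes> inv y \<in> powers"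
proof -
  have "proj x = proj y \<longleftrightarrow> proj x \<otimes>\<^bsub>mod_powers G n\<^esub> inv\<^bsub>mod_powers G n\<^esub> proj y = \<one>\<^bsub>mod_powers G n\<^esub>"
    using assms by (simp add: mod_powers.inv_solve_right')
  also have "\<dots> \<longleftrightarrow> proj (x \<otimes> inv y) = \<one>\<^bsub>mod_powers G n\<^esub>"
    using assms by (metis proj.hom_inv proj.hom_mult inv_closed)
  also have "\<dots> \<longleftrightarrow> x \<otimes> inv y \<in> powers"
    using assms by (simp only: proj_eq_one_iff inv_closed m_closed)
  finally show ?thesis .
qed

lemma root_closed: "x \<in> powers \<Longrightarrow> root x \<in> carrier G"
  unfolding root_def powers_def by (rule inv_into_into)

lemma root_pow: "x \<in> powers \<Longrightarrow> root x [^] n = x"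
  unfolding root_def powers_def by (rule f_inv_into_f)

lemma pow_inject:
  assumes "x \<in> carrier G" "y \<in> carrier G" "x [^] n = y [^] n"
  shows "x = y"
proof -
  have "(x \<otimes> inv y) [^] n = \<one>"
    using assms by (simp add: nat_pow_distrib nat_pow_inv)
  then have "x \<otimes> inv y = \<one>"
    by (rule pow_eq_one[rotated]) (use assms in simp)
  then show ?thesis
    using assms by (simp add: inv_solve_right')
qed

lemma pow_root: "x \<in> carrier G \<Longrightarrow> root (x [^] n) = x"
  by (rule pow_inject) (auto simp: root_pow root_closed powI)

lemma root_mult:
  assumes "x \<in> powers" "y \<in> powers"
  shows "root (x \<otimes> y) = root x \<otimes> root y"
proof (rule pow_inject)
  have "x \<otimes> y \<in> powers"
    using assms subgroup_powers by (simp add: subgroup.m_closed)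
  then show "root (x \<otimes> y) \<in> carrier G" "root (x \<otimes> y) [^] n = (root x \<otimes> root y) [^] n"
    using assms by (simp_all add: root_closed root_pow nat_pow_distrib)
qed (use assms in \<open>simp add: root_closed\<close>)

text \<open>Let \<open>k\<close> be the order of \<open>t\<close> and \<open>d = gcd n k\<close>.
  The power of \<open>t\<close> with exponent \<open>k / d\<close> is killed by \<open>n\<close>,
  hence trivial, and minimality of \<open>k\<close> forces \<open>d = 1\<close>. Bezout then divides
  \<open>t\<close> by \<open>n\<close>.\<close>

lemma torsion_part_subset_powers: "torsion_part G \<subseteq> powers"
proof
  fix t assume "t \<in> torsion_part G"
  then obtain m :: nat where t: "t \<in> carrier G" and m: "m > 0" "t [^] m = \<one>"
    by (auto simp: torsion_part_def)
  define k where "k = (LEAST k::nat. k > 0 \<and> t [^] k = \<one>)"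
  have k: "k > 0" "t [^] k = \<one>"
    using LeastI[of "\<lambda>k::nat. k > 0 \<and> t [^] k = \<one>" m] m by (auto simp: k_def)
  have kmin: "k \<le> j" if "j > 0" "t [^] j = \<one>" for j
    unfolding k_def by (rule Least_le) (use that in simp)
  have "coprime n k"
  proof -
    define d where "d = gcd n k"
    obtain n' k' where n': "n = d * n'" and k': "k = d * k'"
      unfolding d_def by (meson dvdE gcd_dvd1 gcd_dvd2)
    have "(t [^] k') [^] n = (t [^] k) [^] n'"
    proof -
      have "k' * n = k * n'"
        by (subst n', subst k') (simp add: ac_simps)
      then show ?thesis
        using t by (simp only: nat_pow_pow)
    qed
    also have "\<dots> = \<one>"
      by (simp add: k(2))
    finally have "t [^] k' = \<one>"
      by (rule pow_eq_one[OF nat_pow_closed[OF t]])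
    moreover have "k' > 0"
      using k(1) k' by (cases k') simp_all
    ultimately have "k \<le> k'"
      by (intro kmin)
    then have "d * k' \<le> k'"
      by (subst (asm) k')
    then have "d \<le> 1"
      using \<open>k' > 0\<close> by simp
    moreover have "d > 0"
      using k(1) by (simp add: d_def)
    ultimately have "d = 1"
      by simp
    then show ?thesis
      unfolding d_def by (rule gcd_eq_1_imp_coprime)
  qed
  then have "gcd (int n) (int k) = 1"
    by simp
  then obtain a b :: int where ab: "a * int n + b * int k = 1"
    by (metis bezout_int)
  have "t = t [^] (a * int n + b * int k)"
    using t by (simp only: ab int_pow_1)
  also have "\<dots> = t [^] (a * int n) \<otimes> t [^] (int k * b)"
    using t by (simp only: int_pow_mult mult.commute[of b])
  also have "t [^] (int k * b) = \<one>"
    using t k by (simp only: int_pow_pow[symmetric] int_pow_int int_pow_one)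
  also have "t [^] (a * int n) = (t [^] a) [^] n"
    using t by (simp only: int_pow_pow[symmetric] int_pow_int)
  also have "(t [^] a) [^] n \<otimes> \<one> = (t [^] a) [^] n"
    using t by simp
  finally show "t \<in> powers"
    using t powI[of "t [^] a"] by auto
qed

lemma hom_proj_cong:
  assumes f: "f \<in> hom G G" and x: "x \<in> carrier G" "y \<in> carrier G" "proj x = proj y"
  shows "proj (f x) = proj (f y)"
proof -
  interpret f: group_hom G G f
    using f by (simp add: group_hom_def group_hom_axioms_def is_group)
  obtain z where z: "z \<in> carrier G" "x \<otimes> inv y = z [^] n"
    using x by (auto simp: proj_eq_iff powers_def)
  have "f x \<otimes> inv (f y) = f z [^] n"
    using x z by (metis f.hom_inv f.hom_mult f.hom_nat_pow inv_closed)
  then show ?thesis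
    using x z by (simp add: proj_eq_iff powI)
qed

text \<open>Every endomorphism preserves nG and so acts on G/nG; two endomorphisms that are inverse
  to each other only modulo \<open>n\<close> already act there by mutually inverse maps.\<close>

lemma induced_mod_powers_iso:
  assumes f: "f \<in> hom G G" and g: "g \<in> hom G G"
    and fg: "\<And>x. x \<in> carrier G \<Longrightarrow> proj (f (g x)) = proj x"
    and gf: "\<And>x. x \<in> carrier G \<Longrightarrow> proj (g (f x)) = proj x"
  obtains \<phi> where "\<phi> \<in> iso (mod_powers G n) (mod_powers G n)"
    "\<And>x. x \<in> carrier G \<Longrightarrow> \<phi> (proj x) = proj (f x)"
proof -
  have f_closed: "f x \<in> carrier G" and g_closed: "g x \<in> carrier G" if "x \<in> carrier G" for x
    using that f g by (auto simp: hom_def)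
  have "proj \<circ> f \<in> hom G (mod_powers G n)"
    using f proj_hom by (rule Group.hom_compose)
  then obtain \<phi> where \<phi>: "\<phi> \<in> hom (mod_powers G n) (mod_powers G n)"
    and \<phi>_proj: "\<And>x. x \<in> carrier G \<Longrightarrow> \<phi> (proj x) = proj (f x)"
  proof (rule FactGroup_universal[OF _ normal_powers, folded mod_powers_eq proj_def])
    show "(proj \<circ> f) x = (proj \<circ> f) y"
      if "x \<in> carrier G" "y \<in> carrier G" "proj x = proj y" for x y
      using hom_proj_cong[OF f that] by simp
  qed auto
  have "\<phi> \<in> iso (mod_powers G n) (mod_powers G n)"
  proof (rule group_isoI[OF mod_powers.is_group mod_powers.is_group \<phi>])
    show "z = \<one>\<^bsub>mod_powers G n\<^esub>"
      if z: "z \<in> carrier (mod_powers G n)" "\<phi> z = \<one>\<^bsub>mod_powers G n\<^esub>" for z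
    proof -
      obtain x where x: "x \<in> carrier G" "z = proj x"
        using z by (auto simp: carrier_mod_powers)
      have "proj (f x) = proj \<one>"
        using z x \<phi>_proj by simp
      then have "proj (g (f x)) = proj (g \<one>)"
        using x f_closed by (intro hom_proj_cong[OF g]) auto
      also have "g \<one> = \<one>"
        using g by (simp add: hom_one is_group)
      finally show ?thesis
        using x gf by simp
    qed
    show "\<exists>z\<in>carrier (mod_powers G n). \<phi> z = w" if w: "w \<in> carrier (mod_powers G n)" for w
    proof -
      obtain y where y: "y \<in> carrier G" "w = proj y"
        using w by (auto simp: carrier_mod_powers)
      then have "\<phi> (proj (g y)) = w"
        using \<phi>_proj fg g_closed by simp
      then show ?thesis
        using y g_closed by (auto simp: carrier_mod_powers)
    qed
  qed
  then show thesis
    using \<phi>_proj that by blast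
qed

lemma proj_eqI:
  assumes "y \<in> carrier G" "z \<in> carrier G" "x = y \<otimes> z [^] n"
  shows "proj x = proj y"
  using assms by (simp add: proj_pow)

text \<open>The difference of \<open>f\<close> and \<open>\<beta>\<close> takes values in nG.
  Division by \<open>n\<close> is additive there, so the quotient \<open>s\<close> is itself an
  endomorphism.\<close>

lemma proj_eq_homs_imp_power_difference:
  assumes f: "f \<in> hom G G" and b: "\<beta> \<in> hom G G"
    and eq: "\<And>x. x \<in> carrier G \<Longrightarrow> proj (f x) = proj (\<beta> x)"
  obtains s where "s \<in> hom G G" "\<And>x. x \<in> carrier G \<Longrightarrow> f x = s x [^] n \<otimes> \<beta> x"
proof -
  have c: "f x \<in> carrier G" "\<beta> x \<in> carrier G" if "x \<in> carrier G" for x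
    using that f b by (auto simp: hom_def)
  have d: "f x \<otimes> inv \<beta> x \<in> powers" if "x \<in> carrier G" for x
    using eq[OF that] c[OF that] by (simp add: proj_eq_iff)
  define s where "s x = root (f x \<otimes> inv \<beta> x)" for x
  have "s \<in> hom G G"
  proof (rule homI)
    show "s x \<in> carrier G" if "x \<in> carrier G" for x
      unfolding s_def using d[OF that] by (rule root_closed)
    show "s (x \<otimes> y) = s x \<otimes> s y" if xy: "x \<in> carrier G" "y \<in> carrier G" for x y
    proof -
      have "f (x \<otimes> y) \<otimes> inv \<beta> (x \<otimes> y) = (f x \<otimes> inv \<beta> x) \<otimes> (f y \<otimes> inv \<beta> y)"
        using c[OF xy(1)] c[OF xy(2)] hom_mult[OF f xy] hom_mult[OF b xy] by (simp add: inv_mult m_ac)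
      then show ?thesis
        using d[OF xy(1)] d[OF xy(2)] by (simp add: s_def root_mult)
    qed
  qed
  moreover have "f x = s x [^] n \<otimes> \<beta> x" if "x \<in> carrier G" for x
    using c[OF that] root_pow[OF d[OF that]] by (simp add: s_def m_assoc)
  ultimately show thesis
    by (rule that)
qed

end

section \<open>Pullbacks along the reduction modulo \<open>n\<close>\<close>

locale pullback_group = power_injective_group + H: comm_group H
  for H :: "('b, 'm) monoid_scheme" (structure) +
  fixes \<alpha> :: "'b \<Rightarrow> 'a set"
  assumes alpha_epi: "\<alpha> \<in> epi H (mod_powers G n)"
begin

text \<open>Only the carrier depends on \<open>f\<close>, so the pullbacks for different
  \<open>f\<close> share their operation and unit.\<close>

definition pullback :: "('a \<Rightarrow> 'a) \<Rightarrow> ('a \<times> 'b) monoid" where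
  "pullback f = (G \<times>\<times> H)\<lparr>carrier := {(x, h). x \<in> carrier G \<and> h \<in> carrier H \<and> \<alpha> h = proj (f x)}\<rparr>"

lemma pullback_carrier_iff:
  "(x, h) \<in> carrier (pullback f) \<longleftrightarrow> x \<in> carrier G \<and> h \<in> carrier H \<and> \<alpha> h = proj (f x)"
  by (simp add: pullback_def)

lemma pullback_mult [simp]: "p \<otimes>\<^bsub>pullback f\<^esub> q = (fst p \<otimes> fst q, snd p \<otimes>\<^bsub>H\<^esub> snd q)"
  by (simp add: pullback_def mult_DirProd')

lemma pullback_one [simp]: "\<one>\<^bsub>pullback f\<^esub> = (\<one>, \<one>\<^bsub>H\<^esub>)"
  by (simp add: pullback_def)

sublocale alpha: group_hom H "mod_powers G n" \<alpha>
  using alpha_epi by (simp add: group_hom_def group_hom_axioms_def epi_def mod_powers.is_group H.is_group)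

lemma comm_group_pullback:
  assumes "f \<in> hom G G"
  shows "comm_group (pullback f)"
proof -
  interpret f: group_hom G G f
    using assms by (simp add: group_hom_def group_hom_axioms_def is_group)
  show ?thesis
  proof (rule comm_groupI)
    show "\<exists>y\<in>carrier (pullback f). y \<otimes>\<^bsub>pullback f\<^esub> x = \<one>\<^bsub>pullback f\<^esub>"
      if "x \<in> carrier (pullback f)" for x
      using that by (intro bexI[of _ "(inv (fst x), inv\<^bsub>H\<^esub> (snd x))"])
        (auto simp: pullback_def)
  qed (auto simp: pullback_def m_ac H.m_ac)
qed

lemma pullback_nat_pow: "p [^]\<^bsub>pullback f\<^esub> (k::nat) = (fst p [^] k, snd p [^]\<^bsub>H\<^esub> k)"
  by (induction k) auto

text \<open>
  Both sides are isomorphic to the pullback of \<^term>\<open>pullback (\<lambda>x. x)\<close> and \<^term>\<open>pullback f\<close> over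
  \<^term>\<open>H\<close>, an extension of either by a copy of \<^term>\<open>G\<close>; the lifts \<^term>\<open>g\<close> and \<^term>\<open>f\<close> split
  these extensions.
\<close>

lemma pullback_iso:
  assumes f: "f \<in> hom G G" and g: "g \<in> hom G G"
    and fg: "\<And>x. x \<in> carrier G \<Longrightarrow> proj (f (g x)) = proj x"
    and gf: "\<And>x. x \<in> carrier G \<Longrightarrow> proj (g (f x)) = proj x"
  shows "G \<times>\<times> pullback (\<lambda>x. x) \<cong> G \<times>\<times> pullback f"
proof (rule is_isoI, rule group_isoI)
  interpret f: group_hom G G f
    using f by (simp add: group_hom_def group_hom_axioms_def is_group)
  interpret g: group_hom G G g
    using g by (simp add: group_hom_def group_hom_axioms_def is_group)
  interpret M: comm_group "pullback (\<lambda>x. x)"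
    by (rule comm_group_pullback) (simp add: hom_def)
  interpret Mf: comm_group "pullback f"
    by (rule comm_group_pullback[OF f])
  show "group (G \<times>\<times> pullback (\<lambda>x. x))" "group (G \<times>\<times> pullback f)"
    by (rule DirProd_group; unfold_locales)+
  \<comment> \<open>Additively, \<open>(a, y, h)\<close> stands for the triple
    \<open>(y, x, h)\<close> with \<open>x = n a + g y\<close>, a point of the pullback of the two
    groups over \<open>H\<close>. The map \<open>\<Phi>\<close> rewrites this triple as
    \<open>(b, x, h)\<close> with \<open>b = (y - f x) / n\<close>.\<close>
  define shear where "shear a y = a [^] n \<otimes> g y" for a y
  define \<Phi> where "\<Phi> = (\<lambda>(a, y, h). (root (y \<otimes> inv (f (shear a y))), shear a y, h :: 'b))"
  have shear_closed: "shear a y \<in> carrier G" if "a \<in> carrier G" "y \<in> carrier G" for a y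
    using that by (simp add: shear_def)
  have f_shear: "proj (f (shear a y)) = proj y" if "a \<in> carrier G" "y \<in> carrier G" for a y
    using that by (simp add: shear_def f.hom_nat_pow fg proj_pow)
  have diff: "y \<otimes> inv (f (shear a y)) \<in> powers" if "a \<in> carrier G" "y \<in> carrier G" for a y
    using that f_shear[OF that] shear_closed[OF that] proj_eq_iff[of y "f (shear a y)"] by simp
  have shear_mult: "shear (a \<otimes> b) (y \<otimes> z) = shear a y \<otimes> shear b z"
    if "a \<in> carrier G" "y \<in> carrier G" "b \<in> carrier G" "z \<in> carrier G" for a b y z
    using that by (simp add: shear_def nat_pow_distrib m_ac)
  show "\<Phi> \<in> hom (G \<times>\<times> pullback (\<lambda>x. x)) (G \<times>\<times> pullback f)"
  proof (rule homI)
    fix u assume "u \<in> carrier (G \<times>\<times> pullback (\<lambda>x. x))"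
    then obtain a y h where u: "u = (a, y, h)"
      and c: "a \<in> carrier G" "y \<in> carrier G" "h \<in> carrier H" "\<alpha> h = proj y"
      by (auto simp: pullback_def)
    show "\<Phi> u \<in> carrier (G \<times>\<times> pullback f)"
      using c by (simp add: u \<Phi>_def pullback_carrier_iff shear_closed root_closed diff f_shear)
  next
    fix u v
    assume "u \<in> carrier (G \<times>\<times> pullback (\<lambda>x. x))" "v \<in> carrier (G \<times>\<times> pullback (\<lambda>x. x))"
    then obtain a y h b z k where uv: "u = (a, y, h)" "v = (b, z, k)"
      and c: "a \<in> carrier G" "y \<in> carrier G" "h \<in> carrier H" "b \<in> carrier G" "z \<in> carrier G" "k \<in> carrier H"
      by (auto simp: pullback_def)
    have "(y \<otimes> z) \<otimes> inv (f (shear a y \<otimes> shear b z)) = (y \<otimes> inv (f (shear a y))) \<otimes> (z \<otimes> inv (f (shear b z)))"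
      using c shear_closed[of a y] shear_closed[of b z] by (simp add: inv_mult m_ac)
    then show "\<Phi> (u \<otimes>\<^bsub>G \<times>\<times> pullback (\<lambda>x. x)\<^esub> v) = \<Phi> u \<otimes>\<^bsub>G \<times>\<times> pullback f\<^esub> \<Phi> v"
      using c by (simp add: uv \<Phi>_def shear_mult root_mult diff)
  qed
  show "u = \<one>\<^bsub>G \<times>\<times> pullback (\<lambda>x. x)\<^esub>"
    if u: "u \<in> carrier (G \<times>\<times> pullback (\<lambda>x. x))" "\<Phi> u = \<one>\<^bsub>G \<times>\<times> pullback f\<^esub>" for u
  proof -
    obtain a y h where u': "u = (a, y, h)" and c: "a \<in> carrier G" "y \<in> carrier G" "h \<in> carrier H"
      using u by (auto simp: pullback_def)
    have e: "root (y \<otimes> inv (f (shear a y))) = \<one>" "shear a y = \<one>" "h = \<one>\<^bsub>H\<^esub>"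
      using u(2) unfolding u' \<Phi>_def one_DirProd pullback_one prod.case prod.inject by blast+
    have "y = \<one>"
      using root_pow[OF diff[OF c(1,2)]] e c by simp
    moreover from this have "a = \<one>"
      using e(2) c by (intro pow_eq_one[OF c(1)]) (simp add: shear_def)
    ultimately show ?thesis
      using e by (simp add: u')
  qed
  show "\<exists>u\<in>carrier (G \<times>\<times> pullback (\<lambda>x. x)). \<Phi> u = w"
    if w: "w \<in> carrier (G \<times>\<times> pullback f)" for w
  proof -
    obtain b x h where w': "w = (b, x, h)" and c: "b \<in> carrier G" "x \<in> carrier G" "h \<in> carrier H"
      and h: "\<alpha> h = proj (f x)"
      using w by (auto simp: pullback_def)
    \<comment> \<open>The inverse formulas are \<open>y = n b + f x\<close> and
      \<open>a = (x - g y) / n\<close>; the second division is possible because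
      \<open>g (f x)\<close> is congruent to \<open>x\<close>.\<close>
    define y where "y = b [^] n \<otimes> f x"
    have y: "y \<in> carrier G" "proj y = proj (f x)"
      using c by (simp_all add: y_def proj_pow)
    have "proj (g y) = proj (g (f x))"
      using y c by (intro hom_proj_cong[OF g]) auto
    then have "x \<otimes> inv (g y) \<in> powers"
      using c y gf[of x] proj_eq_iff[of x "g y"] by simp
    then obtain a where a: "a \<in> carrier G" "a [^] n = x \<otimes> inv (g y)"
      by (auto simp: powers_def)
    have shear: "shear a y = x"
      using a c y by (simp add: shear_def m_assoc)
    have "y \<otimes> inv (f x) = b [^] n"
      using c by (simp add: y_def m_assoc)
    then have "\<Phi> (a, y, h) = w"
      using c by (simp add: \<Phi>_def shear w' pow_root)
    moreover have "(a, y, h) \<in> carrier (G \<times>\<times> pullback (\<lambda>x. x))"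
      using a y c h by (simp add: pullback_def)
    ultimately show ?thesis
      by blast
  qed
qed

end

section \<open>The projections of the two pullbacks to \<open>H\<close> and their kernels\<close>

locale pullback_pair = pullback_group +
  fixes f g :: "'a \<Rightarrow> 'a"
  assumes f: "f \<in> hom G G" and g: "g \<in> hom G G"
    and fg: "\<And>x. x \<in> carrier G \<Longrightarrow> proj (f (g x)) = proj x"
    and gf: "\<And>x. x \<in> carrier G \<Longrightarrow> proj (g (f x)) = proj x"
    and hom_trivial: "\<And>k x. k \<in> hom G H \<Longrightarrow> x \<in> carrier G \<Longrightarrow> k x = \<one>\<^bsub>H\<^esub>"
begin

abbreviation "M \<equiv> pullback (\<lambda>x. x)"
abbreviation "N \<equiv> pullback f"

sublocale f: group_hom G G f
  using f by (simp add: group_hom_def group_hom_axioms_def is_group)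

sublocale g: group_hom G G g
  using g by (simp add: group_hom_def group_hom_axioms_def is_group)

lemma comm_group_M: "comm_group M"
  by (rule comm_group_pullback) (simp add: hom_def)

lemma comm_group_N: "comm_group N"
  by (rule comm_group_pullback[OF f])

lemma group_M: "group M" and group_N: "group N"
  using comm_group_M comm_group_N by (simp_all add: comm_group_def)

text \<open>Together with \<open>in_M_imp_powers\<close> this identifies the kernel of the
  projection from \<open>M\<close> to \<open>H\<close> with nG; \<open>pow_in_N\<close> and
  \<open>in_N_imp_powers\<close> do the same for \<open>N\<close>.\<close>

lemma pow_in_M: "x \<in> carrier G \<Longrightarrow> (x [^] n, \<one>\<^bsub>H\<^esub>) \<in> carrier M"
  using proj_pow[of x] by (simp add: pullback_carrier_iff)

lemma pow_in_N: "x \<in> carrier G \<Longrightarrow> (x [^] n, \<one>\<^bsub>H\<^esub>) \<in> carrier N"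
  using proj_pow[of "f x"] by (simp add: pullback_carrier_iff f.hom_nat_pow)

lemma in_M_imp_powers: "(x, \<one>\<^bsub>H\<^esub>) \<in> carrier M \<Longrightarrow> x \<in> powers"
  using proj_eq_one_iff[of x] by (simp add: pullback_carrier_iff)

lemma proj_f_cancel:
  assumes "x \<in> carrier G" "y \<in> carrier G" "proj (f x) = proj (f y)"
  shows "proj x = proj y"
proof -
  have "proj (g (f x)) = proj (g (f y))"
    using assms by (intro hom_proj_cong[OF g]) auto
  then show ?thesis
    using assms gf by simp
qed

text \<open>Membership says that \<open>f x\<close> lies in nG. Applying \<open>g\<close>, which
  inverts \<open>f\<close> modulo \<open>n\<close>, puts \<open>x\<close> itself into nG.\<close>

lemma in_N_imp_powers: "(x, \<one>\<^bsub>H\<^esub>) \<in> carrier N \<Longrightarrow> x \<in> powers"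
  using proj_f_cancel[of x \<one>] proj_eq_one_iff[of x] by (simp add: pullback_carrier_iff)

lemma hom_pow_pair: "(\<lambda>x. (x [^] n, \<one>\<^bsub>H\<^esub>)) \<in> hom G M"
  by (auto simp: hom_def pow_in_M nat_pow_distrib)

lemma hom_pow_pair_N: "(\<lambda>x. (x [^] n, \<one>\<^bsub>H\<^esub>)) \<in> hom G N"
  by (auto simp: hom_def pow_in_N nat_pow_distrib)

text \<open>Since Hom(G, H) = 0, every homomorphism from \<open>G\<close> into a pullback lands in
  the kernel of the projection to \<open>H\<close>. The free parameter \<open>f'\<close> allows the
  use for both \<open>M\<close> and \<open>N\<close>.\<close>

lemma snd_hom_trivial:
  assumes "k \<in> hom G (pullback f')" "x \<in> carrier G"
  shows "snd (k x) = \<one>\<^bsub>H\<^esub>"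
proof -
  have "snd \<circ> k \<in> hom G H"
  proof (rule homI)
    show "(snd \<circ> k) y \<in> carrier H" if "y \<in> carrier G" for y
      using hom_in_carrier[OF assms(1) that] by (auto simp: pullback_def)
    show "(snd \<circ> k) (y \<otimes> z) = (snd \<circ> k) y \<otimes>\<^bsub>H\<^esub> (snd \<circ> k) z"
      if "y \<in> carrier G" "z \<in> carrier G" for y z
      using hom_mult[OF assms(1) that] by simp
  qed
  then show ?thesis
    using hom_trivial[of "snd \<circ> k" x] assms(2) by simp
qed

lemma M_section:
  assumes "h \<in> carrier H"
  obtains x where "(x, h) \<in> carrier M"
proof -
  have "\<alpha> h \<in> proj ` carrier G"
    using assms carrier_mod_powers alpha.hom_closed by blast
  then show thesis
    using assms that by (auto simp: pullback_carrier_iff)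
qed

lemma N_section:
  assumes "h \<in> carrier H"
  obtains x where "(x, h) \<in> carrier N"
proof -
  obtain y where y: "(y, h) \<in> carrier M"
    using M_section[OF assms] .
  \<comment> \<open>The map \<open>g\<close> carries a lift of \<open>h\<close> to \<open>M\<close>
    into one to \<open>N\<close>, as \<open>f (g y)\<close> is congruent to
    \<open>y\<close>.\<close>
  then have "(g y, h) \<in> carrier N"
    using fg[of y] by (simp add: pullback_carrier_iff)
  then show thesis
    by (rule that)
qed

section \<open>Automorphisms of \<open>G\<close> and \<open>H\<close> induced by an isomorphism of
  the pullbacks\<close>

context
  fixes \<theta>
  assumes \<theta>: "\<theta> \<in> iso M N"
begin

interpretation \<theta>: group_hom M N \<theta>
  using \<theta> group_M group_N by (simp add: group_hom_def group_hom_axioms_def iso_def)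

lemma theta_inj: "u \<in> carrier M \<Longrightarrow> v \<in> carrier M \<Longrightarrow> \<theta> u = \<theta> v \<Longrightarrow> u = v"
  using \<theta> by (auto simp: iso_def bij_betw_def inj_on_def)

lemma theta_surj:
  assumes "w \<in> carrier N"
  obtains u where "u \<in> carrier M" "\<theta> u = w"
proof -
  have "w \<in> \<theta> ` carrier M"
    using \<theta> assms by (simp add: iso_def bij_betw_def)
  then show thesis
    using that by blast
qed

text \<open>Sending \<open>x\<close> to the image of \<open>(n x, 0)\<close> under
  \<open>\<theta>\<close> is a homomorphism from \<open>G\<close>, so it lands in the kernel of the
  projection from \<open>N\<close>, which is nG; dividing by \<open>n\<close> gives
  \<open>\<beta>\<close>. The same argument for the inverse of \<open>\<theta>\<close> makes
  \<open>\<beta>\<close> onto.\<close>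

lemma kernel_automorphism:
  obtains \<beta> where "\<beta> \<in> iso G G" "\<And>x. x \<in> carrier G \<Longrightarrow> \<theta> (x [^] n, \<one>\<^bsub>H\<^esub>) = (\<beta> x [^] n, \<one>\<^bsub>H\<^esub>)"
proof -
  define a where "a x = \<theta> (x [^] n, \<one>\<^bsub>H\<^esub>)" for x
  have a_hom: "a \<in> hom G N"
    using Group.hom_compose[OF hom_pow_pair \<theta>.homh] by (simp add: a_def[abs_def] comp_def)
  have snd_a: "snd (a x) = \<one>\<^bsub>H\<^esub>" if "x \<in> carrier G" for x
    by (rule snd_hom_trivial[OF a_hom that])
  have a_in: "(fst (a x), \<one>\<^bsub>H\<^esub>) \<in> carrier N" if "x \<in> carrier G" for x
    using hom_in_carrier[OF a_hom that] snd_a[OF that] by (metis prod.collapse)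
  have fst_a: "fst (a x) \<in> powers" if "x \<in> carrier G" for x
    using a_in[OF that] by (rule in_N_imp_powers)
  define \<beta> where "\<beta> x = root (fst (a x))" for x
  have \<beta>: "\<theta> (x [^] n, \<one>\<^bsub>H\<^esub>) = (\<beta> x [^] n, \<one>\<^bsub>H\<^esub>)" if "x \<in> carrier G" for x
    using snd_a[OF that] root_pow[OF fst_a[OF that]]
    by (simp add: \<beta>_def a_def prod_eq_iff)
  have \<beta>_closed: "\<beta> x \<in> carrier G" if "x \<in> carrier G" for x
    unfolding \<beta>_def by (rule root_closed[OF fst_a[OF that]])
  have "\<beta> \<in> iso G G"
  proof (rule group_isoI[OF is_group is_group])
    show "\<beta> \<in> hom G G"
    proof (rule homI)
      fix x y assume "x \<in> carrier G" "y \<in> carrier G"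
      then show "\<beta> (x \<otimes> y) = \<beta> x \<otimes> \<beta> y"
        using hom_mult[OF a_hom, of x y] fst_a by (simp add: \<beta>_def root_mult)
    qed (rule \<beta>_closed)
    show "x = \<one>" if "x \<in> carrier G" "\<beta> x = \<one>" for x
    proof -
      have "\<theta> (x [^] n, \<one>\<^bsub>H\<^esub>) = \<theta> (\<one> [^] n, \<one>\<^bsub>H\<^esub>)"
        using \<beta>[OF that(1)] that(2) \<theta>.hom_one by simp
      then have "(x [^] n, \<one>\<^bsub>H\<^esub>) = (\<one> [^] n, \<one>\<^bsub>H\<^esub>)"
        by (rule theta_inj[OF pow_in_M[OF that(1)] pow_in_M[OF one_closed]])
      then have "x [^] n = \<one>"
        by simp
      then show ?thesis
        using that(1) pow_eq_one by blast
    qed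
    show "\<exists>x\<in>carrier G. \<beta> x = y" if y: "y \<in> carrier G" for y
    proof -
      \<comment> \<open>The counterpart of \<open>a\<close> for the inverse of
        \<open>\<theta>\<close>; it lands in the kernel of the projection from
        \<open>M\<close>.\<close>
      define b where "b = (\<lambda>y. inv_into (carrier M) \<theta> (y [^] n, \<one>\<^bsub>H\<^esub>))"
      have "inv_into (carrier M) \<theta> \<in> hom N M"
        using group.iso_set_sym[OF group_M \<theta>] by (simp add: iso_def)
      then have b_hom: "b \<in> hom G M"
        using Group.hom_compose[OF hom_pow_pair_N] by (simp add: b_def comp_def)
      have \<theta>b: "\<theta> (b y) = (y [^] n, \<one>\<^bsub>H\<^esub>)"
        unfolding b_def by (rule f_inv_into_f) (use \<theta> pow_in_N[OF y] in \<open>simp add: iso_def bij_betw_def\<close>)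
      have b: "b y = (fst (b y), \<one>\<^bsub>H\<^esub>)"
        using snd_hom_trivial[OF b_hom y] by (simp add: prod_eq_iff)
      then have "fst (b y) \<in> powers"
        using hom_in_carrier[OF b_hom y] in_M_imp_powers by metis
      then obtain x where x: "x \<in> carrier G" "fst (b y) = x [^] n"
        by (auto simp: powers_def)
      have "\<theta> (x [^] n, \<one>\<^bsub>H\<^esub>) = (y [^] n, \<one>\<^bsub>H\<^esub>)"
        using \<theta>b b x by simp
      then have "\<beta> x [^] n = y [^] n"
        using \<beta>[OF x(1)] by simp
      then have "\<beta> x = y"
        using x y \<beta>_closed pow_inject by blast
      then show ?thesis
        using x by blast
    qed
  qed
  then show thesis
    using \<beta> that by blast
qed

text \<open>As \<open>\<theta>\<close> maps the kernel of the projection from \<open>M\<close> into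
  that from \<open>N\<close>, it descends to \<open>H\<close>. Because \<open>\<beta>\<close> is
  onto, it maps the one kernel onto the other, which makes the descended map injective.\<close>

lemma quotient_automorphism:
  obtains \<psi> where "\<psi> \<in> iso H H" "\<And>x h. (x, h) \<in> carrier M \<Longrightarrow> snd (\<theta> (x, h)) = \<psi> h"
proof -
  obtain \<beta> where \<beta>: "\<beta> \<in> iso G G"
    and \<theta>\<beta>: "\<And>x. x \<in> carrier G \<Longrightarrow> \<theta> (x [^] n, \<one>\<^bsub>H\<^esub>) = (\<beta> x [^] n, \<one>\<^bsub>H\<^esub>)"
    using kernel_automorphism by blast
  have kernel: "snd (\<theta> (x, \<one>\<^bsub>H\<^esub>)) = \<one>\<^bsub>H\<^esub>" if x: "(x, \<one>\<^bsub>H\<^esub>) \<in> carrier M" for x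
    using in_M_imp_powers[OF x] \<theta>\<beta> by (auto simp: powers_def)
  have \<theta>_closed: "fst (\<theta> (x, h)) \<in> carrier G" "snd (\<theta> (x, h)) \<in> carrier H" if "(x, h) \<in> carrier M" for x h
    using \<theta>.hom_closed[OF that] by (auto simp: pullback_def)
  have \<theta>_mult: "snd (\<theta> (x \<otimes> y, h \<otimes>\<^bsub>H\<^esub> k)) = snd (\<theta> (x, h)) \<otimes>\<^bsub>H\<^esub> snd (\<theta> (y, k))"
    if "(x, h) \<in> carrier M" "(y, k) \<in> carrier M" for x y h k
    using \<theta>.hom_mult[OF that] by simp
  have M_mult: "(x \<otimes> y, h \<otimes>\<^bsub>H\<^esub> k) \<in> carrier M"
    if "(x, h) \<in> carrier M" "(y, k) \<in> carrier M" for x y h k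
    using that by (simp add: pullback_carrier_iff)
  have M_carrier: "x \<in> carrier G" "h \<in> carrier H" if "(x, h) \<in> carrier M" for x h
    using that by (simp_all add: pullback_carrier_iff)
  have indep: "snd (\<theta> (x, h)) = snd (\<theta> (y, h))"
    if x: "(x, h) \<in> carrier M" and y: "(y, h) \<in> carrier M" for x y h
  proof -
    define d where "d = x \<otimes> inv y"
    have d: "(d, \<one>\<^bsub>H\<^esub>) \<in> carrier M"
      using x y by (simp add: d_def pullback_carrier_iff)
    have "(x, h) = (d \<otimes> y, \<one>\<^bsub>H\<^esub> \<otimes>\<^bsub>H\<^esub> h)"
      using M_carrier[OF x] M_carrier[OF y] by (simp add: d_def m_assoc)
    then show ?thesis
      using \<theta>_mult[OF d y] kernel[OF d] \<theta>_closed[OF y] by simp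
  qed
  \<comment> \<open>An arbitrary lift of \<open>h\<close> to \<open>M\<close>; by
    \<open>indep\<close> the resulting \<open>\<psi>\<close> does not depend on the choice.\<close>
  define \<xi> where "\<xi> h = (SOME x. (x, h) \<in> carrier M)" for h
  have \<xi>: "(\<xi> h, h) \<in> carrier M" if "h \<in> carrier H" for h
    unfolding \<xi>_def using M_section[OF that] by (metis someI_ex)
  define \<psi> where "\<psi> h = snd (\<theta> (\<xi> h, h))" for h
  have \<psi>: "snd (\<theta> (x, h)) = \<psi> h" if "(x, h) \<in> carrier M" for x h
    unfolding \<psi>_def using that \<xi>[OF M_carrier(2)[OF that]] by (rule indep)
  have "\<psi> \<in> iso H H"
  proof (rule group_isoI[OF H.is_group H.is_group])
    show "\<psi> \<in> hom H H"
    proof (rule homI)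
      show "\<psi> h \<in> carrier H" if "h \<in> carrier H" for h
        unfolding \<psi>_def using \<xi>[OF that] by (rule \<theta>_closed)
      show "\<psi> (h \<otimes>\<^bsub>H\<^esub> k) = \<psi> h \<otimes>\<^bsub>H\<^esub> \<psi> k" if "h \<in> carrier H" "k \<in> carrier H" for h k
        using \<theta>_mult[OF \<xi> \<xi>, OF that] \<psi>[OF M_mult[OF \<xi> \<xi>, OF that]] by (simp add: \<psi>_def)
    qed
    show "h = \<one>\<^bsub>H\<^esub>" if h: "h \<in> carrier H" "\<psi> h = \<one>\<^bsub>H\<^esub>" for h
    proof -
      have e: "\<theta> (\<xi> h, h) = (fst (\<theta> (\<xi> h, h)), \<one>\<^bsub>H\<^esub>)"
        using h by (simp add: \<psi>_def prod_eq_iff)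
      then have "fst (\<theta> (\<xi> h, h)) \<in> powers"
        using \<theta>.hom_closed[OF \<xi>[OF h(1)]] in_N_imp_powers by metis
      then obtain z where z: "z \<in> carrier G" "fst (\<theta> (\<xi> h, h)) = z [^] n"
        by (auto simp: powers_def)
      obtain w where w: "w \<in> carrier G" "z = \<beta> w"
        using \<beta> z(1) by (auto simp: iso_def bij_betw_def)
      have "\<theta> (\<xi> h, h) = \<theta> (w [^] n, \<one>\<^bsub>H\<^esub>)"
        using e z w \<theta>\<beta> by simp
      then have "(\<xi> h, h) = (w [^] n, \<one>\<^bsub>H\<^esub>)"
        by (rule theta_inj[OF \<xi>[OF h(1)] pow_in_M[OF w(1)]])
      then show ?thesis
        by simp
    qed
    show "\<exists>h\<in>carrier H. \<psi> h = k" if k: "k \<in> carrier H" for k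
    proof -
      obtain y where "(y, k) \<in> carrier N"
        using N_section[OF k] .
      then obtain u where u: "u \<in> carrier M" "\<theta> u = (y, k)"
        by (rule theta_surj)
      then have u': "(fst u, snd u) \<in> carrier M"
        by simp
      have "\<psi> (snd u) = k"
        using \<psi>[OF u'] u(2) by simp
      moreover have "snd u \<in> carrier H"
        using u' by (rule M_carrier)
      ultimately show ?thesis
        by blast
    qed
  qed
  then show thesis
    using \<psi> that by blast
qed

text \<open>Additively, \<open>n (x, h) = (n x, 0) + (0, n h)\<close>. The first coordinate of the
  image of \<open>(0, n h)\<close> under \<open>\<theta>\<close> is a homomorphism in
  \<open>h\<close> from \<open>H\<close> to \<open>G\<close>, so its values are torsion. Hence the
  first coordinate of \<open>\<theta> (x, h)\<close> differs from \<open>\<beta> x\<close> by a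
  torsion element, and torsion elements lie in nG.\<close>

lemma proj_fst_theta:
  assumes torsion: "\<And>k h. k \<in> hom H G \<Longrightarrow> h \<in> carrier H \<Longrightarrow> k h \<in> torsion_part G"
    and n: "n > 0"
    and \<beta>: "\<beta> \<in> iso G G" "\<And>x. x \<in> carrier G \<Longrightarrow> \<theta> (x [^] n, \<one>\<^bsub>H\<^esub>) = (\<beta> x [^] n, \<one>\<^bsub>H\<^esub>)"
    and u: "(x, h) \<in> carrier M"
  shows "proj (fst (\<theta> (x, h))) = proj (\<beta> x)"
proof -
  \<comment> \<open>The projection from \<open>M\<close> to \<open>H\<close> need not split, but
    multiples of \<open>n\<close> in \<open>H\<close> do lift with first coordinate 0, since
    \<open>\<alpha>\<close> maps into a group killed by \<open>n\<close>.\<close>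
  have pow_H: "(\<one>, k [^]\<^bsub>H\<^esub> n) \<in> carrier M" if "k \<in> carrier H" for k
  proof -
    have "\<alpha> k \<in> proj ` carrier G"
      using that carrier_mod_powers alpha.hom_closed by blast
    then obtain z where "z \<in> carrier G" "\<alpha> k = proj z"
      by blast
    then have "\<alpha> (k [^]\<^bsub>H\<^esub> n) = \<one>\<^bsub>mod_powers G n\<^esub>"
      using that proj_pow[of z] by (simp add: alpha.hom_nat_pow proj.hom_nat_pow)
    then show ?thesis
      using that by (simp add: pullback_carrier_iff)
  qed
  define \<gamma> where "\<gamma> k = fst (\<theta> (\<one>, k [^]\<^bsub>H\<^esub> n))" for k
  have \<gamma>_hom: "\<gamma> \<in> hom H G"
  proof (rule homI)
    show "\<gamma> k \<in> carrier G" if "k \<in> carrier H" for k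
      using \<theta>.hom_closed[OF pow_H[OF that]] by (auto simp: \<gamma>_def pullback_def)
    show "\<gamma> (k \<otimes>\<^bsub>H\<^esub> l) = \<gamma> k \<otimes> \<gamma> l" if "k \<in> carrier H" "l \<in> carrier H" for k l
      using \<theta>.hom_mult[OF pow_H pow_H, OF that] that by (simp add: \<gamma>_def H.nat_pow_distrib)
  qed
  define y where "y = fst (\<theta> (x, h))"
  have c: "x \<in> carrier G" "h \<in> carrier H"
    using u by (simp_all add: pullback_carrier_iff)
  have y: "y \<in> carrier G"
    using \<theta>.hom_closed[OF u] by (auto simp: y_def pullback_def)
  have \<beta>x: "\<beta> x \<in> carrier G"
    using \<beta>(1) c by (auto simp: iso_def hom_def)
  have \<gamma>h: "\<gamma> h \<in> carrier G"
    using \<gamma>_hom c by (auto simp: hom_def)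
  have "(x, h) [^]\<^bsub>M\<^esub> n = (x [^] n, \<one>\<^bsub>H\<^esub>) \<otimes>\<^bsub>M\<^esub> (\<one>, h [^]\<^bsub>H\<^esub> n)"
    using c by (simp add: pullback_nat_pow)
  then have "\<theta> (x, h) [^]\<^bsub>N\<^esub> n = \<theta> (x [^] n, \<one>\<^bsub>H\<^esub>) \<otimes>\<^bsub>N\<^esub> \<theta> (\<one>, h [^]\<^bsub>H\<^esub> n)"
    using \<theta>.hom_nat_pow[OF u, of n] \<theta>.hom_mult[OF pow_in_M[OF c(1)] pow_H[OF c(2)]] by simp
  then have "y [^] n = \<beta> x [^] n \<otimes> \<gamma> h"
    using \<beta>(2)[OF c(1)] by (simp add: pullback_nat_pow y_def \<gamma>_def)
  then have "y [^] n = \<gamma> h \<otimes> \<beta> x [^] n"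
    using \<beta>x \<gamma>h by (simp add: m_comm)
  then have "(y \<otimes> inv (\<beta> x)) [^] n = \<gamma> h"
    using y \<beta>x \<gamma>h by (simp add: nat_pow_distrib nat_pow_inv m_assoc)
  moreover obtain m :: nat where "m > 0" "\<gamma> h [^] m = \<one>"
    using torsion[OF \<gamma>_hom c(2)] by (auto simp: torsion_part_def)
  ultimately have "(y \<otimes> inv (\<beta> x)) [^] (n * m) = \<one>"
    using y \<beta>x by (simp flip: nat_pow_pow)
  then have "y \<otimes> inv (\<beta> x) \<in> torsion_part G"
    using y \<beta>x n \<open>m > 0\<close> unfolding torsion_part_def by (auto intro!: exI[of _ "n * m"])
  then show ?thesis
    using torsion_part_subset_powers y \<beta>x by (auto simp: proj_eq_iff y_def)
qed

end

text \<open>An isomorphism of the pullbacks induces \<open>\<beta>\<close> on \<open>G\<close> and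
  \<open>\<psi>\<close> on \<open>H\<close>, and \<open>proj_fst_theta\<close> gives
  \<open>\<alpha> \<psi> = \<phi> \<alpha>\<close> with \<open>\<phi>\<close> induced by
  \<open>f \<circ> \<beta>\<close>. Rigidity makes \<open>\<phi>\<close> equal to 1 or -1. The
  automorphism obtained in the conclusion is therefore the inverse, up to sign, of the one from
  \<open>kernel_automorphism\<close>.\<close>

lemma automorphism_lift:
  assumes torsion: "\<And>k h. k \<in> hom H G \<Longrightarrow> h \<in> carrier H \<Longrightarrow> k h \<in> torsion_part G"
    and n: "n > 0" and rigid: "rigid_epi H (mod_powers G n) \<alpha>" and MN: "M \<cong> N"
  obtains \<beta> where "\<beta> \<in> iso G G" "\<And>x. x \<in> carrier G \<Longrightarrow> proj (f x) = proj (\<beta> x)"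
proof -
  obtain \<theta> where \<theta>: "\<theta> \<in> iso M N"
    using MN by (auto simp: is_iso_def)
  obtain \<beta> where \<beta>: "\<beta> \<in> iso G G"
    and \<theta>\<beta>: "\<And>x. x \<in> carrier G \<Longrightarrow> \<theta> (x [^] n, \<one>\<^bsub>H\<^esub>) = (\<beta> x [^] n, \<one>\<^bsub>H\<^esub>)"
    using kernel_automorphism[OF \<theta>] by blast
  obtain \<psi> where \<psi>: "\<psi> \<in> iso H H"
    and \<theta>\<psi>: "\<And>x h. (x, h) \<in> carrier M \<Longrightarrow> snd (\<theta> (x, h)) = \<psi> h"
    using quotient_automorphism[OF \<theta>] by blast
  define \<beta>' where "\<beta>' = inv_into (carrier G) \<beta>"
  have \<beta>': "\<beta>' \<in> iso G G"
    unfolding \<beta>'_def by (rule iso_set_sym[OF \<beta>])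
  have homs: "\<beta> \<in> hom G G" "\<beta>' \<in> hom G G"
    using \<beta> \<beta>' by (simp_all add: iso_def)
  have closed: "\<beta> x \<in> carrier G" "\<beta>' x \<in> carrier G" if "x \<in> carrier G" for x
    using that homs by (auto simp: hom_def)
  have \<beta>\<beta>': "\<beta> (\<beta>' x) = x" "\<beta>' (\<beta> x) = x" if "x \<in> carrier G" for x
    using \<beta> that by (auto simp: \<beta>'_def iso_def bij_betw_def f_inv_into_f inv_into_f_f)
  \<comment> \<open>These two are inverse to each other modulo \<open>n\<close>, which makes
    \<open>\<phi>\<close> an automorphism.\<close>
  have "f \<circ> \<beta> \<in> hom G G" "\<beta>' \<circ> g \<in> hom G G"
    by (rule Group.hom_compose[OF homs(1) f], rule Group.hom_compose[OF g homs(2)])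
  moreover have "proj ((f \<circ> \<beta>) ((\<beta>' \<circ> g) x)) = proj x" if "x \<in> carrier G" for x
    using that \<beta>\<beta>' fg by simp
  moreover have "proj ((\<beta>' \<circ> g) ((f \<circ> \<beta>) x)) = proj x" if x: "x \<in> carrier G" for x
  proof -
    have "proj (\<beta>' (g (f (\<beta> x)))) = proj (\<beta>' (\<beta> x))"
      using x closed gf by (intro hom_proj_cong[OF homs(2)]) auto
    then show ?thesis
      using x \<beta>\<beta>' by simp
  qed
  ultimately obtain \<phi> where \<phi>: "\<phi> \<in> iso (mod_powers G n) (mod_powers G n)"
    and \<phi>_proj: "\<And>x. x \<in> carrier G \<Longrightarrow> \<phi> (proj x) = proj (f (\<beta> x))"
    using induced_mod_powers_iso[of "f \<circ> \<beta>" "\<beta>' \<circ> g"] unfolding comp_def by metis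
  have "\<alpha> (\<psi> h) = \<phi> (\<alpha> h)" if h: "h \<in> carrier H" for h
  proof -
    obtain x where xh: "(x, h) \<in> carrier M"
      using M_section[OF h] .
    then have x: "x \<in> carrier G" "\<alpha> h = proj x"
      by (simp_all add: pullback_carrier_iff)
    define y where "y = fst (\<theta> (x, h))"
    have "\<theta> (x, h) \<in> carrier N"
      using \<theta> xh by (auto simp: iso_def hom_def)
    then have y: "y \<in> carrier G" "\<alpha> (\<psi> h) = proj (f y)"
      using \<theta>\<psi>[OF xh] by (auto simp: pullback_def y_def)
    have "proj y = proj (\<beta> x)"
      unfolding y_def by (rule proj_fst_theta[OF \<theta> _ n \<beta> _ xh]) (simp_all add: torsion \<theta>\<beta>)
    then have "proj (f y) = proj (f (\<beta> x))"
      using y x closed by (intro hom_proj_cong[OF f]) auto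
    then show ?thesis
      using x y \<phi>_proj by simp
  qed
  then consider "\<And>z. z \<in> carrier (mod_powers G n) \<Longrightarrow> \<phi> z = z"
    | "\<And>z. z \<in> carrier (mod_powers G n) \<Longrightarrow> \<phi> z = inv\<^bsub>mod_powers G n\<^esub> z"
    using rigid \<psi> \<phi> unfolding rigid_epi_def by blast
  then show thesis
  proof cases
    case 1
    \<comment> \<open>Evaluate \<open>\<phi>\<close> at the class of \<open>\<beta>' x\<close>: it
      is the class of \<open>f (\<beta> (\<beta>' x)) = f x\<close>.\<close>
    have "proj (f x) = proj (\<beta>' x)" if "x \<in> carrier G" for x
      using \<phi>_proj[of "\<beta>' x"] 1[of "proj (\<beta>' x)"] that closed \<beta>\<beta>' by simp
    then show thesis
      using \<beta>' that by blast
  next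
    case 2
    have "proj (f x) = proj (inv (\<beta>' x))" if "x \<in> carrier G" for x
      using \<phi>_proj[of "\<beta>' x"] 2[of "proj (\<beta>' x)"] that closed \<beta>\<beta>' by simp
    then show thesis
      using inv_iso[OF \<beta>'] that by blast
  qed
qed

end

section \<open>The endomorphism ring and ideals of multiples\<close>

lemma comm_group_hom_group:
  assumes "comm_group G" "comm_group H"
  shows "comm_group (hom_group G H)"
proof -
  interpret G: comm_group G by fact
  interpret H: comm_group H by fact
  have closed: "f x \<in> carrier H" if "f \<in> hom G H" "x \<in> carrier G" for f x
    using that by (rule hom_in_carrier)
  show ?thesis
  proof (rule comm_groupI)
    fix f g assume "f \<in> carrier (hom_group G H)" "g \<in> carrier (hom_group G H)"
    then have fg: "f \<in> hom G H" "g \<in> hom G H"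
      by (auto simp: hom_group_def)
    show "f \<otimes>\<^bsub>hom_group G H\<^esub> g \<in> carrier (hom_group G H)"
      using fg by (auto simp: hom_group_def hom_def Pi_iff H.m_ac)
    show "f \<otimes>\<^bsub>hom_group G H\<^esub> g = g \<otimes>\<^bsub>hom_group G H\<^esub> f"
      using fg by (auto simp: hom_group_def closed H.m_comm intro!: restrict_ext)
  next
    show "\<one>\<^bsub>hom_group G H\<^esub> \<in> carrier (hom_group G H)"
      by (auto simp: hom_group_def hom_def)
  next
    fix f g h
    assume "f \<in> carrier (hom_group G H)" "g \<in> carrier (hom_group G H)" "h \<in> carrier (hom_group G H)"
    then show "f \<otimes>\<^bsub>hom_group G H\<^esub> g \<otimes>\<^bsub>hom_group G H\<^esub> h = f \<otimes>\<^bsub>hom_group G H\<^esub> (g \<otimes>\<^bsub>hom_group G H\<^esub> h)"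
      by (auto simp: hom_group_def closed H.m_assoc intro!: restrict_ext)
  next
    fix f assume f: "f \<in> carrier (hom_group G H)"
    then show "\<one>\<^bsub>hom_group G H\<^esub> \<otimes>\<^bsub>hom_group G H\<^esub> f = f"
      by (auto simp: hom_group_def closed fun_eq_iff extensional_def)
    have "(\<lambda>x\<in>carrier G. inv\<^bsub>H\<^esub> f x) \<in> carrier (hom_group G H)"
      using f by (auto simp: hom_group_def hom_def Pi_iff H.inv_mult)
    moreover have "(\<lambda>x\<in>carrier G. inv\<^bsub>H\<^esub> f x) \<otimes>\<^bsub>hom_group G H\<^esub> f = \<one>\<^bsub>hom_group G H\<^esub>"
      using f by (auto simp: hom_group_def closed intro!: restrict_ext)
    ultimately show "\<exists>g\<in>carrier (hom_group G H). g \<otimes>\<^bsub>hom_group G H\<^esub> f = \<one>\<^bsub>hom_group G H\<^esub>"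
      by blast
  qed
qed

lemma hom_group_nat_pow:
  "x \<in> carrier G \<Longrightarrow> (f [^]\<^bsub>hom_group G H\<^esub> (k::nat)) x = f x [^]\<^bsub>H\<^esub> k"
  by (induction k) (auto simp: hom_group_def)

section \<open>The endomorphism ring and its ideal of endomorphisms with torsion image\<close>

context comm_group
begin

lemma endo_ring_simps:
  "f \<in> carrier (endo_ring G) \<longleftrightarrow> f \<in> hom G G \<and> f \<in> extensional (carrier G)"
  "x \<in> carrier G \<Longrightarrow> (f \<oplus>\<^bsub>endo_ring G\<^esub> g) x = f x \<otimes> g x"
  "x \<in> carrier G \<Longrightarrow> (f \<otimes>\<^bsub>endo_ring G\<^esub> g) x = f (g x)"
  "x \<in> carrier G \<Longrightarrow> \<one>\<^bsub>endo_ring G\<^esub> x = x"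
  "x \<in> carrier G \<Longrightarrow> \<zero>\<^bsub>endo_ring G\<^esub> x = \<one>"
  by (auto simp: endo_ring_def hom_group_def compose_def)

lemma endo_ring_eqI:
  assumes "f \<in> carrier (endo_ring G)" "g \<in> carrier (endo_ring G)"
    and "\<And>x. x \<in> carrier G \<Longrightarrow> f x = g x"
  shows "f = g"
  using assms extensionalityI[of f "carrier G" g] by (simp add: endo_ring_simps)

lemma endo_closed: "f \<in> carrier (endo_ring G) \<Longrightarrow> x \<in> carrier G \<Longrightarrow> f x \<in> carrier G"
  by (auto simp: endo_ring_simps hom_def)

lemma endo_mult: "f \<in> carrier (endo_ring G) \<Longrightarrow> x \<in> carrier G \<Longrightarrow> y \<in> carrier G \<Longrightarrow> f (x \<otimes> y) = f x \<otimes> f y"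
  by (auto simp: endo_ring_simps hom_def)

text \<open>Elements of \<open>endo_ring\<close> are extensional, so an arbitrary endomorphism
  enters the ring through its restriction.\<close>

lemma restrict_in_endo_ring: "f \<in> hom G G \<Longrightarrow> restrict f (carrier G) \<in> carrier (endo_ring G)"
  by (auto simp: endo_ring_simps hom_def)

lemma ring_endo_ring: "ring (endo_ring G)"
proof (rule ringI)
  have "add_monoid (endo_ring G) = hom_group G G"
    by (simp add: endo_ring_def hom_group_def)
  then show ab: "abelian_group (endo_ring G)"
    using comm_group_hom_group[OF comm_group_axioms comm_group_axioms]
    by (intro comm_group_abelian_groupI) simp
  interpret E: abelian_group "endo_ring G" by fact
  have mult_closed: "f \<otimes>\<^bsub>endo_ring G\<^esub> g \<in> carrier (endo_ring G)"
    if "f \<in> carrier (endo_ring G)" "g \<in> carrier (endo_ring G)" for f g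
    using that by (auto simp: endo_ring_def hom_group_def hom_def compose_def Pi_iff)
  have one_closed: "\<one>\<^bsub>endo_ring G\<^esub> \<in> carrier (endo_ring G)"
    by (auto simp: endo_ring_def hom_group_def hom_def)
  show "monoid (endo_ring G)"
    by (rule monoidI)
      (auto intro!: endo_ring_eqI mult_closed one_closed simp: endo_ring_simps(2-5) endo_closed)
  fix f g h
  assume "f \<in> carrier (endo_ring G)" "g \<in> carrier (endo_ring G)" "h \<in> carrier (endo_ring G)"
  then show "(f \<oplus>\<^bsub>endo_ring G\<^esub> g) \<otimes>\<^bsub>endo_ring G\<^esub> h = f \<otimes>\<^bsub>endo_ring G\<^esub> h \<oplus>\<^bsub>endo_ring G\<^esub> g \<otimes>\<^bsub>endo_ring G\<^esub> h"
    "h \<otimes>\<^bsub>endo_ring G\<^esub> (f \<oplus>\<^bsub>endo_ring G\<^esub> g) = h \<otimes>\<^bsub>endo_ring G\<^esub> f \<oplus>\<^bsub>endo_ring G\<^esub> h \<otimes>\<^bsub>endo_ring G\<^esub> g"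
    by (auto intro!: endo_ring_eqI mult_closed E.a_closed
        simp: endo_ring_simps(2-5) endo_closed endo_mult)
qed

lemma endo_ring_add_pow:
  fixes k :: nat
  assumes "x \<in> carrier G"
  shows "([k] \<cdot>\<^bsub>endo_ring G\<^esub> f) x = f x [^] k"
proof -
  have "add_monoid (endo_ring G) = hom_group G G"
    by (simp add: endo_ring_def hom_group_def)
  then show ?thesis
    using hom_group_nat_pow[OF assms] by (simp add: add_pow_def)
qed

lemma subgroup_torsion_part: "subgroup (torsion_part G) G"
proof
  show "torsion_part G \<subseteq> carrier G"
    by (auto simp: torsion_part_def)
  show "\<one> \<in> torsion_part G"
    by (auto simp: torsion_part_def intro: exI[of _ 1])
  show "x \<otimes> y \<in> torsion_part G" if xy: "x \<in> torsion_part G" "y \<in> torsion_part G" for x y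
  proof -
    obtain k l :: nat where k: "k > 0" "x [^] k = \<one>" and l: "l > 0" "y [^] l = \<one>"
      and c: "x \<in> carrier G" "y \<in> carrier G"
      using xy by (auto simp: torsion_part_def)
    have "(x \<otimes> y) [^] (k * l) = (x [^] k) [^] l \<otimes> (y [^] l) [^] k"
      using c by (simp add: nat_pow_distrib nat_pow_pow mult.commute)
    then show ?thesis
      using k l c unfolding torsion_part_def by (auto intro!: exI[of _ "k * l"])
  qed
  show "inv x \<in> torsion_part G" if "x \<in> torsion_part G" for x
    using that by (auto simp: torsion_part_def nat_pow_inv)
qed

lemma hom_torsion_part:
  assumes "comm_group H" "f \<in> hom G H" "x \<in> torsion_part G"
  shows "f x \<in> torsion_part H"
proof -
  interpret H: comm_group H by fact
  obtain k :: nat where k: "k > 0" "x [^] k = \<one>" "x \<in> carrier G"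
    using assms(3) by (auto simp: torsion_part_def)
  have "f x [^]\<^bsub>H\<^esub> k = f \<one>"
    using hom_of_pow_eq[OF is_group H.is_group assms(2) k(3), of k] k by simp
  then show ?thesis
    using k assms hom_in_carrier[OF assms(2)] hom_one[OF assms(2)]
    by (auto simp: torsion_part_def)
qed

text \<open>The ideal Hom(G, T(G)) that \<open>walk_ring\<close> divides out.\<close>

definition torsion_endos :: "('a \<Rightarrow> 'a) set" where
  "torsion_endos = {f \<in> carrier (endo_ring G). f ` carrier G \<subseteq> torsion_part G}"

lemma torsion_endos_iff:
  "f \<in> torsion_endos \<longleftrightarrow> f \<in> carrier (endo_ring G) \<and> (\<forall>x\<in>carrier G. f x \<in> torsion_part G)"
  by (auto simp: torsion_endos_def)

text \<open>Absorption on the left holds because endomorphisms preserve torsion, absorption on the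
  right because only the outer map decides where the values lie.\<close>

lemma ideal_torsion_endos: "ideal torsion_endos (endo_ring G)"
proof (rule idealI[OF ring_endo_ring])
  interpret E: ring "endo_ring G" by (rule ring_endo_ring)
  have tors: "\<one> \<in> torsion_part G" "\<And>x y. x \<in> torsion_part G \<Longrightarrow> y \<in> torsion_part G \<Longrightarrow> x \<otimes> y \<in> torsion_part G"
    "\<And>x. x \<in> torsion_part G \<Longrightarrow> inv x \<in> torsion_part G" "\<And>x. x \<in> torsion_part G \<Longrightarrow> x \<in> carrier G"
    using subgroup_torsion_part by (simp_all add: subgroup_def subset_iff)
  have neg: "(\<ominus>\<^bsub>endo_ring G\<^esub> f) x = inv (f x)"
    if "f \<in> carrier (endo_ring G)" "x \<in> carrier G" for f x
  proof -
    have "(\<ominus>\<^bsub>endo_ring G\<^esub> f) x \<otimes> f x = \<one>"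
      using E.l_neg[OF that(1)] that endo_ring_simps(2,5) by metis
    then show ?thesis
      using that inv_equality[of "(\<ominus>\<^bsub>endo_ring G\<^esub> f) x" "f x"] by (simp add: endo_closed)
  qed
  show "subgroup torsion_endos (add_monoid (endo_ring G))"
  proof (rule E.add.subgroupI)
    show "torsion_endos \<noteq> {}"
      using tors(1) by (auto simp: torsion_endos_def endo_ring_simps(5) intro!: exI[of _ "\<zero>\<^bsub>endo_ring G\<^esub>"])
    show "\<ominus>\<^bsub>endo_ring G\<^esub> f \<in> torsion_endos" if "f \<in> torsion_endos" for f
      using that tors(3) by (auto simp: torsion_endos_def neg)
  qed (auto simp: torsion_endos_def endo_ring_simps(2) intro!: tors(2))
  show "f \<otimes>\<^bsub>endo_ring G\<^esub> t \<in> torsion_endos" "t \<otimes>\<^bsub>endo_ring G\<^esub> f \<in> torsion_endos"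
    if "t \<in> torsion_endos" "f \<in> carrier (endo_ring G)" for t f
    using that hom_torsion_part[OF comm_group_axioms, of f]
    by (auto simp: torsion_endos_def endo_ring_simps(3) endo_closed endo_ring_simps(1)[of f])
qed

end

section \<open>Ideals of multiples and iterated quotient rings\<close>

lemma (in ring) ideal_multiples_ideal: "ideal (multiples_ideal R n) R"
proof (rule idealI[OF ring_axioms])
  have "group_hom (add_monoid R) (add_monoid R) (\<lambda>x. [n] \<cdot> x)"
    by unfold_locales (auto simp: hom_def add.nat_pow_distrib)
  then show "subgroup (multiples_ideal R n) (add_monoid R)"
    unfolding multiples_ideal_def using group_hom.img_is_subgroup by fastforce
qed (auto simp: multiples_ideal_def add_pow_ldistr add_pow_rdistr)

context ideal
begin

lemma coset_eq_iff:
  assumes "a \<in> carrier R" "b \<in> carrier R"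
  shows "I +> a = I +> b \<longleftrightarrow> (\<exists>t\<in>I. a = t \<oplus> b)"
proof -
  have "I +> a = I +> b \<longleftrightarrow> a \<in> I +> b"
    using assms a_rcos_self a_repr_independence' by metis
  then show ?thesis
    by (auto simp: a_r_coset_def')
qed

lemma coset_add_pow:
  fixes k :: nat
  assumes "a \<in> carrier R"
  shows "[k] \<cdot>\<^bsub>R Quot I\<^esub> (I +> a) = I +> [k] \<cdot> a"
proof -
  interpret h: ring_hom_ring R "R Quot I" "(+>) I"
    by (rule rcos_ring_hom_ring)
  show ?thesis
    using assms by (induction k) (simp_all add: h.S.add.nat_pow_Suc add.nat_pow_Suc h.S.add.nat_pow_0 add.nat_pow_0)
qed

text \<open>Flattens the double quotient of \<open>R\<close> by \<open>I\<close> and then by the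
  multiples of \<open>n\<close> into one equation in \<open>R\<close>: \<open>s\<close> represents
  the class that is multiplied by \<open>n\<close>, and \<open>t\<close> accounts for equality
  modulo \<open>I\<close>. With it, units of the Walk ring modulo \<open>n\<close> become equations
  between endomorphisms.\<close>

lemma coset_multiples_eq_iff:
  assumes a: "a \<in> carrier R" and b: "b \<in> carrier R"
  shows "multiples_ideal (R Quot I) n +>\<^bsub>R Quot I\<^esub> (I +> a)
      = multiples_ideal (R Quot I) n +>\<^bsub>R Quot I\<^esub> (I +> b)
    \<longleftrightarrow> (\<exists>s\<in>carrier R. \<exists>t\<in>I. a = t \<oplus> ([n] \<cdot> s \<oplus> b))"
    (is "?lhs \<longleftrightarrow> ?rhs")
proof -
  interpret h: ring_hom_ring R "R Quot I" "(+>) I"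
    by (rule rcos_ring_hom_ring)
  have J: "ideal (multiples_ideal (R Quot I) n) (R Quot I)"
    by (rule h.S.ideal_multiples_ideal)
  have carr: "carrier (R Quot I) = (+>) I ` carrier R"
    unfolding FactRing_def A_RCOSETS_def' partial_object.simps by (rule UNION_singleton_eq_range)
  have "?lhs \<longleftrightarrow> (\<exists>S\<in>multiples_ideal (R Quot I) n. I +> a = S \<oplus>\<^bsub>R Quot I\<^esub> (I +> b))"
    using a b by (intro ideal.coset_eq_iff[OF J]) (auto simp: carr)
  also have "\<dots> \<longleftrightarrow> (\<exists>s\<in>carrier R. I +> a = [n] \<cdot>\<^bsub>R Quot I\<^esub> (I +> s) \<oplus>\<^bsub>R Quot I\<^esub> (I +> b))"
    by (simp only: multiples_ideal_def carr image_image bex_simps)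
  also have "\<dots> \<longleftrightarrow> (\<exists>s\<in>carrier R. I +> a = I +> ([n] \<cdot> s \<oplus> b))"
    by (rule bex_cong[OF refl]) (simp add: b coset_add_pow)
  also have "\<dots> \<longleftrightarrow> ?rhs"
    by (rule bex_cong[OF refl], rule coset_eq_iff) (simp_all add: a b)
  finally show ?thesis .
qed

end

section \<open>Cancellation and the complement of the \<open>n\<close>-torsion\<close>

text \<open>The pullbacks live on pairs, whereas \<open>cancellation_property\<close> speaks of
  groups on \<open>'u\<close>. As \<open>'u\<close> is infinite, \<open>'u \<times> 'u\<close>
  embeds into it, and the group structure is carried along the embedding.\<close>

lemma comm_group_transport:
  fixes A :: "('u::infinite \<times> 'u) monoid"
  assumes "comm_group A"
  obtains B :: "'u monoid" where "comm_group B" "A \<cong> B"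
proof -
  have "|UNIV \<times> UNIV :: ('u \<times> 'u) set| =o |UNIV :: 'u set|"
    by (rule card_of_Times_same_infinite) (rule infinite_UNIV)
  then obtain e :: "'u \<times> 'u \<Rightarrow> 'u" where "inj e"
    using card_of_ordIso by (metis UNIV_Times_UNIV bij_betw_def)
  define B where "B = \<lparr>carrier = e ` carrier A, monoid.mult = (\<lambda>x y. e (inv_into UNIV e x \<otimes>\<^bsub>A\<^esub> inv_into UNIV e y)), one = e \<one>\<^bsub>A\<^esub>\<rparr>"
  interpret A: comm_group A by fact
  have iso: "e \<in> iso A B"
  proof (rule isoI)
    show "e \<in> hom A B"
      by (rule homI) (simp_all add: B_def inv_f_f[OF \<open>inj e\<close>])
    show "bij_betw e (carrier A) (carrier B)"
      using inj_on_subset[OF \<open>inj e\<close>] by (simp add: B_def bij_betw_def)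
  qed
  \<comment> \<open>The updated unit is the one that \<open>B\<close> has by definition.\<close>
  then have "comm_group (B\<lparr>one := e \<one>\<^bsub>A\<^esub>\<rparr>)"
    by (rule A.iso_imp_img_comm_group)
  moreover have "B\<lparr>one := e \<one>\<^bsub>A\<^esub>\<rparr> = B"
    by (simp add: B_def)
  ultimately show thesis
    using that iso by (auto simp: is_iso_def)
qed

lemma cancellation_property_prod:
  fixes G :: "'u::infinite monoid" and A B :: "('u \<times> 'u) monoid"
  assumes canc: "cancellation_property G" and G: "group G" and A: "comm_group A" and B: "comm_group B"
    and iso: "G \<times>\<times> A \<cong> G \<times>\<times> B"
  shows "A \<cong> B"
proof -
  obtain A' :: "'u monoid" where A': "comm_group A'" "A \<cong> A'"
    using comm_group_transport[OF A] .
  obtain B' :: "'u monoid" where B': "comm_group B'" "B \<cong> B'"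
    using comm_group_transport[OF B] .
  have groups: "group A" "group B" "group A'" "group B'"
    using A B A' B' by (simp_all add: comm_group_def)
  have "G \<times>\<times> A' \<cong> G \<times>\<times> A"
    by (rule group.DirProd_iso_trans[OF G iso_refl group.iso_sym[OF groups(1) A'(2)]])
  also have "\<dots> \<cong> G \<times>\<times> B" by fact
  also have "\<dots> \<cong> G \<times>\<times> B'"
    by (rule group.DirProd_iso_trans[OF G iso_refl B'(2)])
  finally have "A' \<cong> B'"
    using canc A' B' by (auto simp: cancellation_property_def)
  then have "A \<cong> B'"
    by (rule iso_trans[OF A'(2)])
  then show ?thesis
    using group.iso_sym[OF groups(2) B'(2)] by (rule iso_trans)
qed

lemma (in comm_group) comm_group_carrier_update:
  assumes A: "subgroup A G"
  shows "comm_group (G\<lparr>carrier := A\<rparr>)"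
proof (rule group.group_comm_groupI[OF subgroup_imp_group[OF A]])
  fix x y assume "x \<in> carrier (G\<lparr>carrier := A\<rparr>)" "y \<in> carrier (G\<lparr>carrier := A\<rparr>)"
  then have "x \<in> carrier G" "y \<in> carrier G"
    using subgroup.subset[OF A] by auto
  then show "x \<otimes>\<^bsub>G\<lparr>carrier := A\<rparr>\<^esub> y = y \<otimes>\<^bsub>G\<lparr>carrier := A\<rparr>\<^esub> x"
    by (simp add: m_comm)
qed

section \<open>A subgroup with a direct complement\<close>

locale complemented_group = comm_group +
  fixes T C :: "'a set"
  assumes direct_sum: "internal_direct_sum G T C"
begin

abbreviation "CG \<equiv> G\<lparr>carrier := C\<rparr>"
abbreviation "TG \<equiv> G\<lparr>carrier := T\<rparr>"

lemma subgroup_T: "subgroup T G" and subgroup_C: "subgroup C G"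
  using direct_sum by (simp_all add: internal_direct_sum_def)

lemma mem_carrier: "x \<in> T \<Longrightarrow> x \<in> carrier G" "x \<in> C \<Longrightarrow> x \<in> carrier G"
  using subgroup.subset[OF subgroup_T] subgroup.subset[OF subgroup_C] by auto

lemma disjoint: "x \<in> T \<Longrightarrow> x \<in> C \<Longrightarrow> x = \<one>"
  using direct_sum by (auto simp: internal_direct_sum_def)

lemma decomposition:
  assumes "x \<in> carrier G"
  obtains t c where "t \<in> T" "c \<in> C" "x = t \<otimes> c"
proof -
  have "x \<in> T <#> C"
    using assms direct_sum by (simp add: internal_direct_sum_def)
  then show thesis
    using that by (auto simp: set_mult_def)
qed

lemma comm_group_CG: "comm_group CG" and comm_group_TG: "comm_group TG"
  by (simp_all add: comm_group_carrier_update subgroup_C subgroup_T)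

lemma sum_iso: "(\<lambda>(t, c). t \<otimes> c) \<in> iso (TG \<times>\<times> CG) G"
proof (rule group_isoI)
  show "group (TG \<times>\<times> CG)"
    using comm_group_CG comm_group_TG by (simp add: DirProd_group comm_group_def)
  show "(\<lambda>(t, c). t \<otimes> c) \<in> hom (TG \<times>\<times> CG) G"
    by (rule homI) (auto simp: mem_carrier m_ac)
  show "u = \<one>\<^bsub>TG \<times>\<times> CG\<^esub>" if u: "u \<in> carrier (TG \<times>\<times> CG)" "(case u of (t, c) \<Rightarrow> t \<otimes> c) = \<one>" for u
  proof -
    obtain t c where tc: "u = (t, c)" "t \<in> T" "c \<in> C" "t \<otimes> c = \<one>"
      using u by auto
    then have "t = inv c"
      using inv_equality[of t c] mem_carrier by simp
    then have "t \<in> C"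
      using tc(3) subgroup_C by (simp add: subgroup.m_inv_closed)
    then have "t = \<one>"
      using tc disjoint by blast
    then show ?thesis
      using tc mem_carrier by simp
  qed
  show "\<exists>u\<in>carrier (TG \<times>\<times> CG). (case u of (t, c) \<Rightarrow> t \<otimes> c) = x" if x: "x \<in> carrier G" for x
  proof -
    obtain t c where "t \<in> T" "c \<in> C" "x = t \<otimes> c"
      using decomposition[OF x] .
    then show ?thesis
      by (intro bexI[of _ "(t, c)"]) simp_all
  qed
qed (rule is_group)

text \<open>Regroup \<open>G \<times>\<times> A\<close> as the product of \<open>TG\<close> and
  \<open>CG \<times>\<times> A\<close>, and likewise for \<open>B\<close>. This turns the
  isomorphism built over the complement into one to which cancellation of \<open>G\<close>
  applies.\<close>

lemma complement_cancel:
  assumes "group A" "group B" and iso: "CG \<times>\<times> A \<cong> CG \<times>\<times> B"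
  shows "G \<times>\<times> A \<cong> G \<times>\<times> B"
proof -
  have TC: "group TG" "group CG"
    using comm_group_CG comm_group_TG by (simp_all add: comm_group_def)
  have assoc: "(TG \<times>\<times> CG) \<times>\<times> D \<cong> TG \<times>\<times> (CG \<times>\<times> D)" for D :: "('x, 'y) monoid_scheme"
  proof (rule is_isoI)
    show "(\<lambda>((t, c), x). (t, c, x)) \<in> iso ((TG \<times>\<times> CG) \<times>\<times> D) (TG \<times>\<times> (CG \<times>\<times> D))"
      by (auto simp: iso_def hom_def bij_betw_def inj_on_def image_iff)
  qed
  have G: "G \<times>\<times> D \<cong> TG \<times>\<times> (CG \<times>\<times> D)" for D :: "('x, 'y) monoid_scheme"
  proof -
    have "G \<cong> TG \<times>\<times> CG"
      by (rule group.iso_sym[OF DirProd_group[OF TC] is_isoI[OF sum_iso]])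
    then have "G \<times>\<times> D \<cong> (TG \<times>\<times> CG) \<times>\<times> D"
      by (rule DirProd_iso_trans[OF _ iso_refl])
    then show ?thesis
      using assoc by (rule iso_trans)
  qed
  have "TG \<times>\<times> (CG \<times>\<times> A) \<cong> TG \<times>\<times> (CG \<times>\<times> B)"
    by (rule group.DirProd_iso_trans[OF TC(1) iso_refl iso])
  moreover have "group (G \<times>\<times> B)"
    using assms by (simp add: DirProd_group is_group)
  moreover from this have "TG \<times>\<times> (CG \<times>\<times> B) \<cong> G \<times>\<times> B"
    using G by (rule group.iso_sym)
  ultimately show ?thesis
    using iso_trans[OF G iso_trans] by blast
qed

text \<open>The map \<open>p\<close> is the second coordinate of the inverse of
  \<open>sum_iso\<close>; the last property says that what remains of \<open>x\<close> is its
  component in \<open>T\<close>.\<close>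

lemma projection:
  obtains p where "p \<in> hom G CG" "\<And>x. x \<in> C \<Longrightarrow> p x = x" "\<And>x. x \<in> T \<Longrightarrow> p x = \<one>"
    "\<And>x. x \<in> carrier G \<Longrightarrow> x \<otimes> inv (p x) \<in> T"
proof -
  define \<mu> where "\<mu> = inv_into (carrier (TG \<times>\<times> CG)) (\<lambda>(t, c). t \<otimes> c)"
  have "group (TG \<times>\<times> CG)"
    using comm_group_CG comm_group_TG by (simp add: DirProd_group comm_group_def)
  then have \<mu>_hom: "\<mu> \<in> hom G (TG \<times>\<times> CG)"
    unfolding \<mu>_def using group.iso_set_sym[OF _ sum_iso] by (simp add: iso_def)
  have inj: "inj_on (\<lambda>(t, c). t \<otimes> c) (carrier (TG \<times>\<times> CG))"
    using sum_iso by (simp add: iso_def bij_betw_def)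
  have \<mu>: "\<mu> (t \<otimes> c) = (t, c)" if "t \<in> T" "c \<in> C" for t c
    using inv_into_f_f[OF inj, of "(t, c)"] that by (simp add: \<mu>_def)
  define p where "p = snd \<circ> \<mu>"
  have p: "p (t \<otimes> c) = c" if "t \<in> T" "c \<in> C" for t c
    using \<mu>[OF that] by (simp add: p_def)
  show thesis
  proof (rule that)
    show "p \<in> hom G CG"
      using \<mu>_hom by (simp add: hom_pairwise p_def)
    show "p x = x" if "x \<in> C" for x
      using p[of \<one> x] that subgroup_T mem_carrier by (simp add: subgroup.one_closed)
    show "p x = \<one>" if "x \<in> T" for x
      using p[of x \<one>] that subgroup_C mem_carrier by (simp add: subgroup.one_closed)
    show "x \<otimes> inv (p x) \<in> T" if x: "x \<in> carrier G" for x
    proof -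
      obtain t c where "t \<in> T" "c \<in> C" "x = t \<otimes> c"
        using decomposition[OF x] .
      then show ?thesis
        using p mem_carrier by (simp add: m_assoc)
    qed
  qed
qed

end

section \<open>The \<open>n\<close>-torsion part and its complement\<close>

context comm_group
begin

lemma n_torsion_part_subset: "n_torsion_part G n \<subseteq> torsion_part G"
proof -
  have "(\<Union>p\<in>{p. Factorial_Ring.prime p \<and> p dvd n}. p_component G p) \<subseteq> torsion_part G"
    unfolding p_component_def torsion_part_def
    by (auto simp del: power_Suc) (metis prime_gt_0_nat zero_less_power)
  then show ?thesis
    unfolding n_torsion_part_def by (intro generate_subgroup_incl subgroup_torsion_part)
qed

lemma p_component_subset_n_torsion_part:
  "Factorial_Ring.prime p \<Longrightarrow> p dvd n \<Longrightarrow> p_component G p \<subseteq> n_torsion_part G n"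
  unfolding n_torsion_part_def by (auto intro: generate.incl)

text \<open>Endomorphisms map each p-component into itself, and the p-components with
  \<open>p\<close> dividing \<open>n\<close> generate the \<open>n\<close>-torsion part.\<close>

lemma hom_n_torsion_part:
  assumes f: "f \<in> hom G G" and x: "x \<in> n_torsion_part G n"
  shows "f x \<in> n_torsion_part G n"
proof -
  interpret f: group_hom G G f
    using f by (simp add: group_hom_def group_hom_axioms_def is_group)
  define S where "S = (\<Union>p\<in>{p. Factorial_Ring.prime p \<and> p dvd n}. p_component G p)"
  have S: "S \<subseteq> carrier G"
    by (auto simp: S_def p_component_def)
  have "f ` S \<subseteq> S"
  proof
    fix y assume "y \<in> f ` S"
    then obtain x p k where "Factorial_Ring.prime p" "p dvd n" "x \<in> carrier G" "x [^] (p ^ k) = \<one>" "y = f x"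
      by (auto simp: S_def p_component_def)
    then have "y \<in> p_component G p"
      using f.hom_nat_pow[of x "p ^ k"] by (auto simp: p_component_def)
    then show "y \<in> S"
      using \<open>Factorial_Ring.prime p\<close> \<open>p dvd n\<close> by (auto simp: S_def)
  qed
  then have "f ` generate G S \<subseteq> generate G S"
    using f.generate_img[OF S] mono_generate by metis
  then show ?thesis
    using x by (auto simp: n_torsion_part_def S_def)
qed

lemma power_injective_complement:
  assumes n: "n > 0" and C: "subgroup C G" and disj: "n_torsion_part G n \<inter> C = {\<one>}"
  shows "power_injective_group (G\<lparr>carrier := C\<rparr>) n"
proof -
  \<comment> \<open>Passing to all divisors \<open>m\<close> of \<open>n\<close> permits induction:
    for a prime \<open>p\<close> dividing \<open>m\<close>, the element \<open>p x\<close> of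
    \<open>C\<close> is killed by \<open>m / p\<close>, hence trivial, so \<open>x\<close> lies in
    the p-component and in \<open>C\<close>.\<close>
  have "x = \<one>" if "m dvd n" "x \<in> C" "x [^] m = \<one>" for m :: nat and x
  proof -
    have "m > 0"
      using n \<open>m dvd n\<close> by (simp add: dvd_pos_nat)
    then show ?thesis
      using that
    proof (induction m arbitrary: x rule: less_induct)
      case (less m)
      have x: "x \<in> carrier G"
        using less.prems C subgroup.mem_carrier by metis
      show ?case
      proof (cases "m = 1")
        case True
        then show ?thesis
          using less.prems x by simp
      next
        case False
        then obtain p where p: "Factorial_Ring.prime p" "p dvd m"
          using prime_factor_nat by blast
        then obtain k where k: "m = p * k"
          by (elim dvdE)
        have "k < m" "k > 0"
          using k less.prems(1) prime_gt_1_nat[OF p(1)] by (auto intro: gr0I)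
        have "x [^] p \<in> C"
          using subgroup_int_pow_closed[OF C less.prems(3), of "int p"] by (simp add: int_pow_int)
        moreover have "(x [^] p) [^] k = \<one>"
          using less.prems x k by (simp add: nat_pow_pow)
        moreover have "k dvd n"
          using less.prems k dvd_mult_right by blast
        ultimately have "x [^] p = \<one>"
          using less.IH \<open>k < m\<close> \<open>k > 0\<close> by blast
        then have "x [^] (p ^ 1) = \<one>"
          by simp
        then have "x \<in> p_component G p"
          using x unfolding p_component_def by blast
        moreover have "p dvd n"
          using p less.prems dvd_trans by blast
        ultimately show ?thesis
          using p_component_subset_n_torsion_part[OF p(1)] disj less.prems by blast
      qed
    qed
  qed
  moreover have "comm_group (G\<lparr>carrier := C\<rparr>)"
    using C by (rule comm_group_carrier_update)
  ultimately show ?thesis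
  proof (intro power_injective_group.intro power_injective_group_axioms.intro)
    show "x = \<one>\<^bsub>G\<lparr>carrier := C\<rparr>\<^esub>"
      if inj: "\<And>m x. m dvd n \<Longrightarrow> x \<in> C \<Longrightarrow> x [^] m = \<one> \<Longrightarrow> x = \<one>"
        and x: "x \<in> carrier (G\<lparr>carrier := C\<rparr>)" "x [^]\<^bsub>G\<lparr>carrier := C\<rparr>\<^esub> n = \<one>\<^bsub>G\<lparr>carrier := C\<rparr>\<^esub>" for x
      using inj[of n x] x by (simp add: nat_pow_def)
  qed
qed

end

section \<open>Lifting units\<close>

lemma trivial_hom_groupD:
  assumes "comm_group G" "comm_group H" "trivial_group (hom_group G H)"
    and "k \<in> hom G H" "x \<in> carrier G"
  shows "k x = \<one>\<^bsub>H\<^esub>"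
proof -
  \<comment> \<open>The map \<open>k\<close> need not be extensional, so the assumption on
    \<open>hom_group\<close> is applied to its restriction.\<close>
  have "restrict k (carrier G) \<in> carrier (hom_group G H)"
    using assms(1,4) by (auto simp: hom_group_def hom_def comm_group_def group_def monoid.m_closed)
  then have "restrict k (carrier G) = \<one>\<^bsub>hom_group G H\<^esub>"
    using assms(3) by (simp add: trivial_group_def)
  then have "restrict k (carrier G) x = \<one>\<^bsub>hom_group G H\<^esub> x"
    by simp
  then show ?thesis
    using assms(5) by (simp add: hom_group_def)
qed

lemma torsion_hom_groupD:
  assumes "comm_group G" "comm_group H" "torsion_group (hom_group G H)"
    and "k \<in> hom G H" "x \<in> carrier G"
  shows "k x \<in> torsion_part H"
proof -
  have "restrict k (carrier G) \<in> carrier (hom_group G H)"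
    using assms(1,4) by (auto simp: hom_group_def hom_def comm_group_def group_def monoid.m_closed)
  then have "restrict k (carrier G) \<in> torsion_part (hom_group G H)"
    using assms(3) by (simp add: torsion_group_def)
  then obtain m :: nat where m: "m > 0" "restrict k (carrier G) [^]\<^bsub>hom_group G H\<^esub> m = \<one>\<^bsub>hom_group G H\<^esub>"
    by (auto simp: torsion_part_def)
  have "k x [^]\<^bsub>H\<^esub> m = (restrict k (carrier G) [^]\<^bsub>hom_group G H\<^esub> m) x"
    using assms(5) by (simp add: hom_group_nat_pow)
  also have "\<dots> = \<one>\<^bsub>H\<^esub>"
    using m(2) assms(5) by (simp add: hom_group_def)
  finally show ?thesis
    using m(1) hom_in_carrier[OF assms(4,5)] by (auto simp: torsion_part_def)
qed

text \<open>The assumptions say pointwise that \<open>f\<close> and \<open>g\<close> are inverse to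
  each other up to torsion and multiples of \<open>n\<close>. Compressed to \<open>C\<close> by
  \<open>p\<close>, they become inverse modulo \<open>n\<close> alone, and
  \<open>automorphism_lift\<close> applies on \<open>C\<close>. In the conclusion \<open>s\<close>
  and \<open>t\<close> are homomorphisms, as an equation in the endomorphism ring requires.\<close>

lemma endomorphism_lift:
  fixes G :: "'u::infinite monoid" (structure) and H :: "'u monoid"
  assumes G: "comm_group G" and n: "n > 0"
    and sum: "internal_direct_sum G (n_torsion_part G n) C"
    and H: "comm_group H" and rigid: "rigid_epi H (mod_powers (G\<lparr>carrier := C\<rparr>) n) \<alpha>"
    and GH: "trivial_group (hom_group G H)" and HG: "torsion_group (hom_group H G)"
    and canc: "cancellation_property G"
    and f: "f \<in> hom G G" and g: "g \<in> hom G G"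
    and fg: "\<And>x. x \<in> carrier G \<Longrightarrow> \<exists>s\<in>carrier G. \<exists>t\<in>torsion_part G. f (g x) = t \<otimes> (s [^] n \<otimes> x)"
    and gf: "\<And>x. x \<in> carrier G \<Longrightarrow> \<exists>s\<in>carrier G. \<exists>t\<in>torsion_part G. g (f x) = t \<otimes> (s [^] n \<otimes> x)"
  obtains v s t where "v \<in> iso G G" "s \<in> hom G G" "t \<in> hom G G"
    "\<And>x. x \<in> carrier G \<Longrightarrow> t x \<in> torsion_part G"
    "\<And>x. x \<in> carrier G \<Longrightarrow> f x = t x \<otimes> (s x [^] n \<otimes> v x)"
proof -
  define T where "T = n_torsion_part G n"
  interpret comm_group G by fact
  interpret complemented_group G T C
    using sum by unfold_locales (simp add: T_def)
  interpret H: comm_group H by fact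
  interpret P: power_injective_group CG n
    using power_injective_complement[OF n subgroup_C] sum by (simp add: internal_direct_sum_def)
  obtain p where p_hom: "p \<in> hom G CG" and p_C: "\<And>x. x \<in> C \<Longrightarrow> p x = x"
    and p_T: "\<And>x. x \<in> T \<Longrightarrow> p x = \<one>" and p_diff: "\<And>x. x \<in> carrier G \<Longrightarrow> x \<otimes> inv (p x) \<in> T"
    using projection by blast
  have p_in: "p x \<in> C" if "x \<in> carrier G" for x
    using p_hom that by (auto simp: hom_def)
  have p_mult: "p (x \<otimes> y) = p x \<otimes> p y" if "x \<in> carrier G" "y \<in> carrier G" for x y
    using p_hom that by (auto simp: hom_def)
  have incl: "k \<in> hom CG A" if "k \<in> hom G A" for k and A :: "('x, 'y) monoid_scheme"
    using that mem_carrier(2) by (auto simp: hom_def)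
  have pow_CG: "x [^]\<^bsub>CG\<^esub> k = x [^] k" for x and k :: nat
    by (simp add: nat_pow_def)
  have k_closed: "k x \<in> carrier G" if "k \<in> hom G G" "x \<in> carrier G" for k x
    using that by (rule hom_in_carrier)
  \<comment> \<open>The subgroup \<open>T\<close> is fully invariant and killed by \<open>p\<close>,
    so \<open>p (k x)\<close> depends only on the component \<open>p x\<close>.\<close>
  have reduce: "p (k (p x)) = p (k x)" if k: "k \<in> hom G G" and x: "x \<in> carrier G" for k x
  proof -
    define t where "t = x \<otimes> inv (p x)"
    have t: "t \<in> T" "t \<in> carrier G" and px: "p x \<in> carrier G"
      using p_diff[OF x] mem_carrier p_in[OF x] by (auto simp: t_def)
    have "x = t \<otimes> p x"
      using x px by (simp add: t_def m_assoc)
    then have "k x = k t \<otimes> k (p x)"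
      using hom_mult[OF k t(2) px] by simp
    moreover have "p (k t) = \<one>"
      using hom_n_torsion_part[OF k] t(1) p_T by (simp add: T_def)
    ultimately show ?thesis
      using k_closed[OF k] t(2) px p_in mem_carrier(2) by (simp add: p_mult)
  qed
  \<comment> \<open>The torsion error is absorbed: \<open>p t\<close> is torsion in \<open>C\<close>
    and hence an \<open>n\<close>-th power there.\<close>
  have proj_comp: "P.proj (p (k (p (l x)))) = P.proj x"
    if k: "k \<in> hom G G" and l: "l \<in> hom G G" and x: "x \<in> C"
      and s: "s \<in> carrier G" and t: "t \<in> torsion_part G" and eq: "k (l x) = t \<otimes> (s [^] n \<otimes> x)"
    for k l x s t
  proof -
    have xG: "x \<in> carrier G" and tG: "t \<in> carrier G"
      using x t mem_carrier by (auto simp: torsion_part_def)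
    have "p t \<in> P.powers"
      using hom_torsion_part[OF comm_group_CG p_hom t] P.torsion_part_subset_powers by blast
    then obtain z where z: "z \<in> C" "p t = z [^] n"
      by (auto simp: P.powers_def pow_CG)
    have "p (k (p (l x))) = p (k (l x))"
      using reduce[OF k] k_closed[OF l xG] .
    also have "\<dots> = p t \<otimes> (p (s [^] n) \<otimes> x)"
      using s tG xG x by (simp add: eq p_mult p_C)
    also have "p (s [^] n) = p s [^] n"
      using hom_of_pow_eq[OF is_group _ p_hom s] comm_group_CG by (simp add: comm_group_def pow_CG)
    also have "p t \<otimes> (p s [^] n \<otimes> x) = x \<otimes> (z \<otimes> p s) [^] n"
      using z p_in[OF s] xG mem_carrier(2) by (simp add: nat_pow_distrib m_ac)
    finally show ?thesis
      using P.proj_eqI[of x "z \<otimes> p s"] x z p_in[OF s] subgroup_C by (simp add: pow_CG subgroup.m_closed)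
  qed
  have comp_hom: "p \<circ> k \<in> hom CG CG" if "k \<in> hom G G" for k
    using incl[OF Group.hom_compose[OF that p_hom]] .
  interpret Q: pullback_pair CG n H \<alpha> "p \<circ> f" "p \<circ> g"
  proof unfold_locales
    show "\<alpha> \<in> epi H (mod_powers CG n)"
      using rigid by (simp add: rigid_epi_def)
    show "p \<circ> f \<in> hom CG CG" "p \<circ> g \<in> hom CG CG"
      by (rule comp_hom[OF f] comp_hom[OF g])+
    show "P.proj ((p \<circ> f) ((p \<circ> g) x)) = P.proj x" if x: "x \<in> carrier CG" for x
    proof -
      have xC: "x \<in> C"
        using x by simp
      obtain s t where "s \<in> carrier G" "t \<in> torsion_part G" "f (g x) = t \<otimes> (s [^] n \<otimes> x)"
        using fg[OF mem_carrier(2)[OF xC]] by blast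
      then show ?thesis
        using proj_comp[OF f g xC] by simp
    qed
    show "P.proj ((p \<circ> g) ((p \<circ> f) x)) = P.proj x" if x: "x \<in> carrier CG" for x
    proof -
      have xC: "x \<in> C"
        using x by simp
      obtain s t where "s \<in> carrier G" "t \<in> torsion_part G" "g (f x) = t \<otimes> (s [^] n \<otimes> x)"
        using gf[OF mem_carrier(2)[OF xC]] by blast
      then show ?thesis
        using proj_comp[OF g f xC] by simp
    qed
    \<comment> \<open>\<open>k \<circ> p\<close> extends \<open>k\<close> to \<open>G\<close>, where
      all homomorphisms to \<open>H\<close> vanish.\<close>
    show "k x = \<one>\<^bsub>H\<^esub>" if k: "k \<in> hom CG H" and x: "x \<in> carrier CG" for k x
    proof -
      have "(k \<circ> p) x = \<one>\<^bsub>H\<^esub>"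
        using trivial_hom_groupD[OF G H GH Group.hom_compose[OF p_hom k]] x mem_carrier by simp
      then show ?thesis
        using x p_C by simp
    qed
  qed
  have "G \<times>\<times> Q.M \<cong> G \<times>\<times> Q.N"
    by (rule complement_cancel[OF Q.group_M Q.group_N Q.pullback_iso[OF Q.f Q.g Q.fg Q.gf]])
  then have "Q.M \<cong> Q.N"
    by (rule cancellation_property_prod[OF canc is_group Q.comm_group_M Q.comm_group_N])
  moreover have "k h \<in> torsion_part CG" if k: "k \<in> hom H CG" and h: "h \<in> carrier H" for k h
  proof -
    have "k \<in> hom H G"
      using k mem_carrier by (auto simp: hom_def)
    then have "k h \<in> torsion_part G"
      using torsion_hom_groupD[OF H G HG] h by blast
    then show ?thesis
      using hom_in_carrier[OF k h] by (auto simp: torsion_part_def pow_CG)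
  qed
  ultimately obtain \<beta> where \<beta>: "\<beta> \<in> iso CG CG"
    and \<beta>_proj: "\<And>x. x \<in> C \<Longrightarrow> P.proj ((p \<circ> f) x) = P.proj (\<beta> x)"
    using Q.automorphism_lift[OF _ n rigid] by auto
  have \<beta>_hom: "\<beta> \<in> hom CG CG"
    using \<beta> by (simp add: iso_def)
  have \<beta>_C: "\<beta> x \<in> C" if "x \<in> C" for x
    using hom_in_carrier[OF \<beta>_hom] that by simp
  obtain s where s_hom: "s \<in> hom CG CG"
    and s: "\<And>x. x \<in> C \<Longrightarrow> p (f x) = s x [^] n \<otimes> \<beta> x"
    using P.proj_eq_homs_imp_power_difference[OF comp_hom[OF f] \<beta>_hom] \<beta>_proj by (auto simp: pow_CG)
  have to_G: "k \<circ> p \<in> hom G G" if "k \<in> hom CG CG" for k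
    using Group.hom_compose[OF p_hom that] mem_carrier(2) by (auto simp: hom_def)
  define d where "d x = x \<otimes> inv (p x)" for x
  have pG: "p x \<in> carrier G" if "x \<in> carrier G" for x
    using p_in[OF that] mem_carrier by simp
  have d_T: "d x \<in> T" if "x \<in> carrier G" for x
    using p_diff[OF that] by (simp add: d_def)
  have d_hom: "d \<in> hom G G"
    using p_mult pG by (auto simp: hom_def d_def inv_mult m_ac)
  \<comment> \<open>As \<open>d\<close> is the projection onto \<open>T\<close>, \<open>v\<close> is
    the identity on \<open>T\<close> and \<open>\<beta>\<close> on \<open>C\<close>.\<close>
  define v where "v x = d x \<otimes> \<beta> (p x)" for x
  have \<beta>pG: "\<beta> (p x) \<in> carrier G" if "x \<in> carrier G" for x
    using \<beta>_C[OF p_in[OF that]] mem_carrier by simp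
  have dG: "d x \<in> carrier G" if "x \<in> carrier G" for x
    using d_T[OF that] mem_carrier by simp
  have v_hom: "v \<in> hom G G"
  proof (rule homI)
    show "v x \<in> carrier G" if "x \<in> carrier G" for x
      using \<beta>pG[OF that] dG[OF that] by (simp add: v_def)
    show "v (x \<otimes> y) = v x \<otimes> v y" if x: "x \<in> carrier G" and y: "y \<in> carrier G" for x y
      using hom_mult[OF d_hom x y] hom_mult[OF to_G[OF \<beta>_hom] x y] \<beta>pG[OF x] \<beta>pG[OF y] dG[OF x] dG[OF y]
      by (simp add: v_def m_ac)
  qed
  have p_v: "p (v x) = \<beta> (p x)" if "x \<in> carrier G" for x
    using p_mult[OF dG \<beta>pG, OF that that] p_T[OF d_T[OF that]] p_C[OF \<beta>_C[OF p_in[OF that]]] \<beta>pG[OF that]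
    by (simp add: v_def)
  have "v \<in> iso G G"
  proof (rule group_isoI[OF is_group is_group v_hom])
    show "x = \<one>" if x: "x \<in> carrier G" "v x = \<one>" for x
    proof -
      have p1: "p \<one> = \<one>"
        using p_C subgroup.one_closed[OF subgroup_C] by simp
      have "\<beta> \<one> = \<one>"
        using hom_one[OF \<beta>_hom] comm_group_CG by (simp add: comm_group_def)
      moreover have "\<beta> (p x) = \<one>"
        using p_v[OF x(1)] x(2) p1 by simp
      moreover have "inj_on \<beta> C"
        using \<beta> by (simp add: iso_def bij_betw_def)
      ultimately have "p x = \<one>"
        using p_in[OF x(1)] subgroup.one_closed[OF subgroup_C] by (metis inj_onD)
      then show ?thesis
        using x \<open>\<beta> \<one> = \<one>\<close> by (simp add: v_def d_def)
    qed
    show "\<exists>x\<in>carrier G. v x = y" if y: "y \<in> carrier G" for y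
    proof -
      have "p y \<in> \<beta> ` C"
        using \<beta> p_in[OF y] by (simp add: iso_def bij_betw_def)
      then obtain c where c: "c \<in> C" "\<beta> c = p y"
        by auto
      \<comment> \<open>Keep the component of \<open>y\<close> in \<open>T\<close> and replace the
        one in \<open>C\<close> by its preimage under \<open>\<beta>\<close>.\<close>
      define x where "x = d y \<otimes> c"
      have cG: "c \<in> carrier G"
        using c(1) mem_carrier by simp
      have x: "x \<in> carrier G" "p x = c"
        using dG[OF y] cG p_mult[OF dG[OF y] cG] p_T[OF d_T[OF y]] p_C[OF c(1)] by (simp_all add: x_def)
      have "d x = d y"
        unfolding d_def[of x] x(2) using dG[OF y] cG by (simp add: x_def m_assoc)
      then have "v x = y"
        using x c y pG[OF y] by (simp add: v_def d_def[of y] m_assoc)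
      then show ?thesis
        using x(1) by blast
    qed
  qed
  moreover have "s \<circ> p \<in> hom G G"
    by (rule to_G[OF s_hom])
  \<comment> \<open>On components in \<open>C\<close>, \<open>f x\<close> and \<open>v x\<close>
    differ by an \<open>n\<close>-th power. Their components in \<open>T\<close> are
    \<open>d (f x)\<close> and \<open>d x\<close>, and \<open>t\<close> is the difference of
    these.\<close>
  moreover define t where "t x = d (f x) \<otimes> inv (d x)" for x
  have "t \<in> hom G G"
  proof (rule homI)
    show "t x \<in> carrier G" if "x \<in> carrier G" for x
      using dG[OF that] dG[OF k_closed[OF f that]] by (simp add: t_def)
    show "t (x \<otimes> y) = t x \<otimes> t y" if x: "x \<in> carrier G" and y: "y \<in> carrier G" for x y
      using hom_mult[OF f x y] hom_mult[OF d_hom x y] hom_mult[OF d_hom k_closed[OF f x] k_closed[OF f y]]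
        dG[OF x] dG[OF y] dG[OF k_closed[OF f x]] dG[OF k_closed[OF f y]]
      by (simp add: t_def inv_mult m_ac)
  qed
  moreover have "t x \<in> torsion_part G" if x: "x \<in> carrier G" for x
  proof -
    have "t x \<in> T"
      using d_T[OF x] d_T[OF k_closed[OF f x]] subgroup_T
      by (simp add: t_def subgroup.m_closed subgroup.m_inv_closed)
    then show ?thesis
      using n_torsion_part_subset by (auto simp: T_def)
  qed
  moreover have "f x = t x \<otimes> ((s \<circ> p) x [^] n \<otimes> v x)" if x: "x \<in> carrier G" for x
  proof -
    have c: "f x \<in> carrier G" "d x \<in> carrier G" "d (f x) \<in> carrier G" "p (f x) \<in> carrier G"
      "s (p x) \<in> carrier G" "\<beta> (p x) \<in> carrier G"
      using k_closed[OF f x] dG[OF x] dG[OF k_closed[OF f x]] pG[OF k_closed[OF f x]]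
        hom_in_carrier[OF to_G[OF s_hom] x] \<beta>pG[OF x] by simp_all
    have "f x = d (f x) \<otimes> p (f x)"
      using c by (simp add: d_def m_assoc)
    also have "p (f x) = s (p x) [^] n \<otimes> \<beta> (p x)"
      using s[OF p_in[OF x]] reduce[OF f x] by simp
    also have "d (f x) \<otimes> (s (p x) [^] n \<otimes> \<beta> (p x))
        = d (f x) \<otimes> (inv (d x) \<otimes> d x) \<otimes> (s (p x) [^] n \<otimes> \<beta> (p x))"
      using c by simp
    also have "\<dots> = d (f x) \<otimes> inv (d x) \<otimes> (s (p x) [^] n \<otimes> (d x \<otimes> \<beta> (p x)))"
      using c inv_closed[OF c(2)] by (simp only: m_ac m_closed nat_pow_closed)
    finally show ?thesis
      by (simp add: t_def v_def)
  qed
  ultimately show thesis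
    by (rule that)
qed


theorem proposition3p1:
  fixes G :: "'u::infinite monoid" and n :: nat and C :: "'u set"
  assumes "comm_group G"
    and "self_small G"
    and "finite_torsion_free_rank G"
    and "n > 0"
    and "internal_direct_sum G (n_torsion_part G n) C"
    and "\<exists>H :: 'u monoid. comm_group H \<and> torsion_free_group H \<and>
           (\<exists>\<alpha>. rigid_epi H (mod_powers (G\<lparr>carrier := C\<rparr>) n) \<alpha>) \<and>
           trivial_group (hom_group G H) \<and>
           torsion_group (hom_group H G)"
    and "cancellation_property G"
  shows "\<forall>u \<in> Units (walk_ring G Quot multiples_ideal (walk_ring G) n).
           \<exists>v \<in> Units (walk_ring G).
             u = multiples_ideal (walk_ring G) n +>\<^bsub>walk_ring G\<^esub> v"
proof
  fix u assume u: "u \<in> Units (walk_ring G Quot multiples_ideal (walk_ring G) n)"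
  interpret comm_group G by fact
  define W where "W = walk_ring G"
  have W_eq: "W = endo_ring G Quot torsion_endos"
    by (simp add: W_def walk_ring_def torsion_endos_def)
  define J where "J = multiples_ideal W n"
  \<comment> \<open>\<open>cls\<close> and \<open>cls2\<close> are the canonical maps from the
    endomorphism ring to the Walk ring and to its reduction modulo \<open>n\<close>.\<close>
  define cls where "cls a = torsion_endos +>\<^bsub>endo_ring G\<^esub> a" for a
  define cls2 where "cls2 a = J +>\<^bsub>W\<^esub> cls a" for a
  interpret I: ideal torsion_endos "endo_ring G"
    by (rule ideal_torsion_endos)
  interpret W: ring W
    unfolding W_eq by (rule I.quotient_is_ring)
  have J: "ideal J W"
    unfolding J_def by (rule W.ideal_multiples_ideal)
  have cls_hom: "cls \<in> ring_hom (endo_ring G) W"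
    using I.rcos_ring_hom by (simp add: cls_def[abs_def] W_eq)
  have cls2_hom: "cls2 \<in> ring_hom (endo_ring G) (W Quot J)"
    using ring_hom_trans[OF cls_hom ideal.rcos_ring_hom[OF J]]
    by (simp add: cls2_def[abs_def] comp_def)
  have carrier_Quot: "carrier (R Quot L) = (\<lambda>a. L +>\<^bsub>R\<^esub> a) ` carrier R"
    for R :: "('x, 'y) ring_scheme" and L
    unfolding FactRing_def A_RCOSETS_def' partial_object.simps by (rule UNION_singleton_eq_range)
  have surj: "\<exists>a\<in>carrier (endo_ring G). w = cls2 a" if "w \<in> carrier (W Quot J)" for w
    using that by (simp add: carrier_Quot cls2_def cls_def W_eq image_iff)
  have cls2_eq_iff: "cls2 a = cls2 b \<longleftrightarrow>
      (\<exists>s\<in>carrier (endo_ring G). \<exists>t\<in>torsion_endos.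
        a = t \<oplus>\<^bsub>endo_ring G\<^esub> ([n] \<cdot>\<^bsub>endo_ring G\<^esub> s \<oplus>\<^bsub>endo_ring G\<^esub> b))"
    if "a \<in> carrier (endo_ring G)" "b \<in> carrier (endo_ring G)" for a b
    using I.coset_multiples_eq_iff[OF that, of n] by (simp only: cls2_def cls_def J_def W_eq)
  obtain w where u_in: "u \<in> carrier (W Quot J)" and w_in: "w \<in> carrier (W Quot J)"
    and wu: "w \<otimes>\<^bsub>W Quot J\<^esub> u = \<one>\<^bsub>W Quot J\<^esub>" and uw: "u \<otimes>\<^bsub>W Quot J\<^esub> w = \<one>\<^bsub>W Quot J\<^esub>"
    using u by (auto simp: Units_def W_def J_def)
  obtain f where f: "f \<in> carrier (endo_ring G)" "u = cls2 f"
    using surj[OF u_in] by blast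
  obtain g where g: "g \<in> carrier (endo_ring G)" "w = cls2 g"
    using surj[OF w_in] by blast
  \<comment> \<open>Lift the relation to the endomorphism ring and evaluate at \<open>x\<close>;
    this is needed for both orders of \<open>f\<close> and \<open>g\<close>.\<close>
  have pointwise: "\<exists>s\<in>carrier G. \<exists>t\<in>torsion_part G. a (b x) = t \<otimes>\<^bsub>G\<^esub> (s [^]\<^bsub>G\<^esub> n \<otimes>\<^bsub>G\<^esub> x)"
    if a: "a \<in> carrier (endo_ring G)" and b: "b \<in> carrier (endo_ring G)"
      and ab: "cls2 a \<otimes>\<^bsub>W Quot J\<^esub> cls2 b = \<one>\<^bsub>W Quot J\<^esub>" and x: "x \<in> carrier G" for a b x
  proof -
    have "cls2 (a \<otimes>\<^bsub>endo_ring G\<^esub> b) = cls2 \<one>\<^bsub>endo_ring G\<^esub>"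
      using ab ring_hom_mult[OF cls2_hom a b] ring_hom_one[OF cls2_hom] by simp
    then obtain s t where s: "s \<in> carrier (endo_ring G)" and t: "t \<in> torsion_endos"
      and eq: "a \<otimes>\<^bsub>endo_ring G\<^esub> b = t \<oplus>\<^bsub>endo_ring G\<^esub> ([n] \<cdot>\<^bsub>endo_ring G\<^esub> s \<oplus>\<^bsub>endo_ring G\<^esub> \<one>\<^bsub>endo_ring G\<^esub>)"
      using cls2_eq_iff[of "a \<otimes>\<^bsub>endo_ring G\<^esub> b" "\<one>\<^bsub>endo_ring G\<^esub>"] a b by auto
    have "a (b x) = t x \<otimes>\<^bsub>G\<^esub> (s x [^]\<^bsub>G\<^esub> n \<otimes>\<^bsub>G\<^esub> x)"
      using fun_cong[OF eq, of x] x by (simp add: endo_ring_simps(2-4) endo_ring_add_pow)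
    moreover have "t x \<in> torsion_part G"
      using t x torsion_endos_iff by blast
    ultimately show ?thesis
      by (intro bexI[of _ "s x"] bexI[of _ "t x"] endo_closed[OF s x])
  qed
  obtain H :: "'u monoid" and \<alpha> where H: "comm_group H" "rigid_epi H (mod_powers (G\<lparr>carrier := C\<rparr>) n) \<alpha>"
    "trivial_group (hom_group G H)" "torsion_group (hom_group H G)"
    using assms(6) by blast
  have fg_hom: "f \<in> hom G G" "g \<in> hom G G"
    using f(1) g(1) by (simp_all add: endo_ring_simps(1))
  obtain v s t where v: "v \<in> iso G G" and s: "s \<in> hom G G" and t: "t \<in> hom G G"
    and t_tors: "\<And>x. x \<in> carrier G \<Longrightarrow> t x \<in> torsion_part G"
    and f_eq: "\<And>x. x \<in> carrier G \<Longrightarrow> f x = t x \<otimes>\<^bsub>G\<^esub> (s x [^]\<^bsub>G\<^esub> n \<otimes>\<^bsub>G\<^esub> v x)"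
    using endomorphism_lift[OF assms(1,4,5) H assms(7) fg_hom
        pointwise[OF f(1) g(1) uw[unfolded f(2) g(2)]] pointwise[OF g(1) f(1) wu[unfolded f(2) g(2)]]]
    by blast
  define v' where "v' = inv_into (carrier G) v"
  have v': "v' \<in> iso G G"
    unfolding v'_def by (rule iso_set_sym[OF v])
  have homs: "v \<in> hom G G" "v' \<in> hom G G"
    using v v' by (simp_all add: iso_def)
  have vv': "v (v' x) = x" "v' (v x) = x" if "x \<in> carrier G" for x
    using v that by (auto simp: v'_def iso_def bij_betw_def f_inv_into_f inv_into_f_f)
  define r where "r k = restrict k (carrier G)" for k :: "'u \<Rightarrow> 'u"
  have r_in: "r k \<in> carrier (endo_ring G)" if "k \<in> hom G G" for k
    unfolding r_def by (rule restrict_in_endo_ring[OF that])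
  have r: "r k x = k x" if "x \<in> carrier G" for k x
    using that by (simp add: r_def)
  have t_in: "r t \<in> torsion_endos"
    unfolding torsion_endos_iff using r_in[OF t] t_tors r by simp
  have ns: "[n] \<cdot>\<^bsub>endo_ring G\<^esub> r s \<in> carrier (endo_ring G)"
    using r_in[OF s] by simp
  \<comment> \<open>This is the form in which \<open>cls2_eq_iff\<close> shows that \<open>f\<close>
    and the automorphism \<open>v\<close> have the same class.\<close>
  have "f = r t \<oplus>\<^bsub>endo_ring G\<^esub> ([n] \<cdot>\<^bsub>endo_ring G\<^esub> r s \<oplus>\<^bsub>endo_ring G\<^esub> r v)"
    using f(1) r_in[OF t] ns r_in[OF homs(1)]
    by (intro endo_ring_eqI I.a_closed) (simp_all add: endo_ring_simps(2) endo_ring_add_pow r f_eq)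
  then have "u = cls2 (r v)"
    using cls2_eq_iff[OF f(1) r_in[OF homs(1)]] t_in r_in[OF s] f(2) by blast
  moreover have "cls (r v) \<in> Units W"
  proof -
    \<comment> \<open>Applied in both orders to \<open>v\<close> and \<open>v'\<close>, this makes
      \<open>v\<close> a unit of the endomorphism ring, and \<open>cls\<close> preserves
      units.\<close>
    have inverse: "r k \<otimes>\<^bsub>endo_ring G\<^esub> r l = \<one>\<^bsub>endo_ring G\<^esub>"
      if k: "k \<in> hom G G" and l: "l \<in> hom G G" and kl: "\<And>x. x \<in> carrier G \<Longrightarrow> k (l x) = x" for k l
    proof (rule endo_ring_eqI[OF I.m_closed[OF r_in[OF k] r_in[OF l]] I.one_closed])
      show "(r k \<otimes>\<^bsub>endo_ring G\<^esub> r l) x = \<one>\<^bsub>endo_ring G\<^esub> x" if x: "x \<in> carrier G" for x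
        using kl[OF x] hom_in_carrier[OF l x] by (simp only: endo_ring_simps(3,4)[OF x] r[OF x] r)
    qed
    have "r v \<otimes>\<^bsub>endo_ring G\<^esub> r v' = \<one>\<^bsub>endo_ring G\<^esub>" "r v' \<otimes>\<^bsub>endo_ring G\<^esub> r v = \<one>\<^bsub>endo_ring G\<^esub>"
      by (rule inverse[OF homs vv'(1)] inverse[OF homs(2,1) vv'(2)]; assumption)+
    then have "cls (r v) \<otimes>\<^bsub>W\<^esub> cls (r v') = \<one>\<^bsub>W\<^esub>" "cls (r v') \<otimes>\<^bsub>W\<^esub> cls (r v) = \<one>\<^bsub>W\<^esub>"
      using ring_hom_mult[OF cls_hom] ring_hom_one[OF cls_hom] r_in[OF homs(1)] r_in[OF homs(2)] by metis+
    then show ?thesis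
      using ring_hom_closed[OF cls_hom r_in] homs by (auto simp: Units_def)
  qed
  ultimately show "\<exists>v\<in>Units (walk_ring G). u = multiples_ideal (walk_ring G) n +>\<^bsub>walk_ring G\<^esub> v"
    by (auto simp: cls2_def W_def J_def)
qed

end
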